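(* Let $\mathtt z>0$ satisfy $\mathtt z\le\mathfrak g^2/4$, and suppose that conditions (I), (ED0), (L0), (C) below hold. Then with probability at least $1-(2e^{-\mathtt z}+8.4e^{-\mathfrak g^2/4})$ one has $\widetilde\theta\in\Theta_n(\mathtt z)$ and $$\|D_n(\widetilde\theta-\theta^* )-\xi\|\le\diamondsuit(n,\mathtt z):=\mathtt r_0(\mathtt z)\,\delta_n(\mathtt r_0(\mathtt z)).$$
   Context: Setting. Fix integers $d,p\ge1$, $n\ge1$, a bandwidth $h>0$ and a point $x_0\in\mathbb R^d$. Let $X_1,\dots,X_n$ be i.i.d. random vectors in $\mathbb R^d$ with Lebesgue density $f$. Let $K:\mathbb R^d\to[0,\infty)$ be a bounded measurable kernel vanishing outside $[-1,1]^d$, and let $\psi_0,\dots,\psi_{p-1}:[-1,1]^d\to\mathbb R$ be bounded measurable functions with $\psi_0\equiv1$, linearly independent on $\{K>0\}$; write $\Psi(t)=(\psi_0(t),\dots,\psi_{p-1}(t))^\top$ (extended by $0$ outside $[-1,1]^d$). Put $T_i=(X_i-x_0)/h$ and define the local log-likelihood $$L(\theta)=\sum_{i=1}^n K(T_i)\Psi(T_i)^\top\theta-nh^d\int_{[-1,1]^d}K(t)\exp(\Psi(t)^\top\theta)\,dt,\qquad \theta\in\mathbb R^p.$$ Let $\widetilde\theta=\arg\max_\theta L(\theta)$ and $\theta^*=\arg\max_\theta \mathbf E L(\theta)$ (both assumed to exist). Define $D_n^2(\theta)=-\nabla^2\mathbf E L(\theta)=nh^d\int K(t)\Psi(t)\Psi(t)^\top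 e^{\Psi(t)^\top\theta}dt$, $D_n^2=D_n^2(\theta^* )$ with $D_n$ its symmetric positive definite square root, score vector $\xi=D_n^{-1}\nabla L(\theta^* )$, and $V_n^2=\mathrm{Var}(\nabla L(\theta^* ))$ (assumed positive definite). Set $\zeta(p,\mathtt z)=\mathfrak a\nu_0(\sqrt p+\sqrt{2\mathtt z})$, $\mathtt r_0(\mathtt z)=4\mathfrak a\nu_0(\sqrt p+\sqrt{2\mathtt z})$ and $\Theta_n(\mathtt z)=\{\theta:\|D_n(\theta-\theta^* )\|\le\mathtt r_0(\mathtt z)\}$. $\|\cdot\|$ is the Euclidean norm on vectors and operator norm on matrices; $\succeq$ is the Loewner order. Conditions. (I): $\mathfrak a^2D_n^2\succeq V_n^2$ for a constant $\mathfrak a>0$. (ED0): there are $\mathfrak g,\nu_0>0$ such that with $\boldsymbol\zeta=V_n^{-1}\nabla L(\theta^* )-\mathbf E V_n^{-1}\nabla L(\theta^* )$, for all nonzero $\gamma\in\mathbb R^p$ and all $|\lambda|\le\mathfrak g$, $\log\mathbf E\exp(\lambda\gamma^\top\boldsymbol\zeta/\|\gamma\|)\le\nu_0^2\lambda^2/2$. (L0): there is $\delta_n(\mathtt r_0(\mathtt z))\ge0$ such that for all $\theta\in\Theta_n(\mathtt z)$, $\|I_p-D_n^{-1}D_n^2(\theta)D_n^{-1}\|\le\delta_n(\mathtt r_0(\mathtt z))$. (C): $\mathtt r_0(\mathtt z)\,(1-\delta_n(\mathtt r_0(\mathtt z)))\ge2\zeta(p,\mathtt z)$. *)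

theory Defs
  imports "HOL-Probability.Probability"
begin

definition unit_cube :: "(real^'d) set" where
  "unit_cube = cbox (- 1) 1"

definition rescale :: "real \<Rightarrow> real^'d \<Rightarrow> real^'d \<Rightarrow> real^'d" where
  "rescale h x0 x = (1 / h) *\<^sub>R (x - x0)"

definition loglik ::
  "(real^'d \<Rightarrow> real) \<Rightarrow> (real^'d \<Rightarrow> real^'p) \<Rightarrow> ('w \<Rightarrow> nat \<Rightarrow> real^'d) \<Rightarrow> nat \<Rightarrow> real
     \<Rightarrow> real^'d \<Rightarrow> real^'p \<Rightarrow> 'w \<Rightarrow> real" where
  "loglik K Psi X n h x0 \<theta> \<omega> =
     (\<Sum>i<n. K (rescale h x0 (X \<omega> i)) * (Psi (rescale h x0 (X \<omega> i)) \<bullet> \<theta>))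
     - real n * h ^ CARD('d) * (\<integral>t\<in>unit_cube. K t * exp (Psi t \<bullet> \<theta>) \<partial>lborel)"

definition grad_at :: "(real^'p \<Rightarrow> real) \<Rightarrow> real^'p \<Rightarrow> real^'p" where
  "grad_at F x = (THE g. (F has_derivative (\<lambda>v. g \<bullet> v)) (at x))"

definition Dn2 ::
  "(real^'d \<Rightarrow> real) \<Rightarrow> (real^'d \<Rightarrow> real^'p) \<Rightarrow> nat \<Rightarrow> real \<Rightarrow> real^'p \<Rightarrow> real^'p^'p" where
  "Dn2 K Psi n h \<theta> = (\<chi> j k. real n * h ^ CARD('d) *
      (\<integral>t\<in>unit_cube. K t * (Psi t $ j) * (Psi t $ k) * exp (Psi t \<bullet> \<theta>) \<partial>lborel))"

definition covmat :: "'w measure \<Rightarrow> ('w \<Rightarrow> real^'p) \<Rightarrow> real^'p^'p" where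
  "covmat M G = (\<chi> j k. (\<integral>\<omega>. (G \<omega> $ j - (\<integral>\<omega>'. G \<omega>' $ j \<partial>M)) *
                               (G \<omega> $ k - (\<integral>\<omega>'. G \<omega>' $ k \<partial>M)) \<partial>M))"

definition loewner_le :: "real^'p^'p \<Rightarrow> real^'p^'p \<Rightarrow> bool" where
  "loewner_le A B \<longleftrightarrow> (\<forall>x. 0 \<le> x \<bullet> ((B - A) *v x))"

definition sym_mat :: "real^'p^'p \<Rightarrow> bool" where
  "sym_mat A \<longleftrightarrow> transpose A = A"

definition pos_def :: "real^'p^'p \<Rightarrow> bool" where
  "pos_def A \<longleftrightarrow> (\<forall>x. x \<noteq> 0 \<longrightarrow> 0 < x \<bullet> (A *v x))"

definition opnorm :: "real^'p^'q \<Rightarrow> real" where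
  "opnorm A = onorm (\<lambda>x. A *v x)"

end

theory Submission
  imports Defs
begin

text \<open>
  The score is centred at \<open>\<theta>\<^sup>*\<close>, and its standardization \<open>\<zeta> = V\<inverse> \<nabla>L(\<theta>\<^sup>*)\<close> has identity
  covariance, so (ED0) forces \<open>\<nu>\<^sub>0 \<ge> 1\<close>. Condition (ED0) also bounds the moments of order \<open>2k\<close> of
  every projection of \<open>\<zeta>\<close>; these bounds are homogeneous in the direction, so averaging them over
  a standard Gaussian direction gives a bound on \<open>E \<parallel>\<zeta>\<parallel>\<^sup>2\<^sup>k\<close>. Markov's inequality with
  \<open>k = \<lfloor>2z\<rfloor>\<close> yields \<open>P(\<parallel>\<zeta>\<parallel> \<ge> 2\<nu>\<^sub>0(\<surd>p + \<surd>(2z))) \<le> 2exp(-z)\<close>: the factor 2 in front of \<open>\<nu>\<^sub>0\<close> is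
  the one that condition (C) leaves free, and it dispenses with any lower bound on \<open>g\<close> in
  terms of \<open>p\<close>.

  By (I), \<open>\<parallel>\<xi>\<parallel> \<le> a\<parallel>\<zeta>\<parallel> < r\<^sub>0(1 - \<delta>)\<close> off this event. Both maximizers are critical points, so
  \<open>\<nabla>L(\<theta>\<^sup>*)\<close> is the increment, from \<open>\<theta>\<^sup>*\<close> to the maximizer of \<open>L\<close>, of the gradient of the convex
  part of \<open>-L\<close>. In the coordinates \<open>u = D(\<theta> - \<theta>\<^sup>*)\<close> this gradient is a monotone map \<open>F\<close> whose
  derivative is within \<open>\<delta>\<close> of the identity on the ball of radius \<open>r\<^sub>0\<close>. There \<open>F(u) - F(0)\<close> is
  within \<open>r\<^sub>0\<delta>\<close> of \<open>u\<close>, hence has norm at least \<open>r\<^sub>0(1 - \<delta>)\<close> on the bounding sphere and, by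
  monotonicity, outside the ball.
\<close>

section \<open>The standard Gaussian measure on a Euclidean space\<close>

definition std_gaussian :: "'a::euclidean_space measure" where
  "std_gaussian =
    distr (\<Pi>\<^sub>M b\<in>Basis. std_normal_distribution) borel (\<lambda>f. \<Sum>b\<in>Basis. f b *\<^sub>R b)"

lemma prob_space_std_normal_distribution: "prob_space std_normal_distribution"
  by (rule prob_space_normal_density) simp

lemma sets_std_gaussian [measurable_cong, simp]: "sets std_gaussian = sets borel"
  by (simp add: std_gaussian_def)

lemma prob_space_std_gaussian: "prob_space std_gaussian"
  unfolding std_gaussian_def
  by (intro prob_space.prob_space_distr prob_space_PiM prob_space_std_normal_distribution) measurable

lemma fact_double_div: "fact (2 * k) / (2 ^ k * fact k) = 2 ^ k * pochhammer (1/2 :: real) k"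
  unfolding fact_double by (simp add: mult_2 power_add)

lemma nn_integral_std_normal_even_power:
  "(\<integral>\<^sup>+x. ennreal (x ^ (2 * k)) \<partial>std_normal_distribution) = ennreal (2 ^ k * pochhammer (1/2) k)"
  using std_normal_distribution_even_moments[of k]
  by (subst nn_integral_eq_integral) (auto simp: fact_double_div power_mult)

lemma nn_integral_add_power_pochhammer:
  fixes F :: "'a \<Rightarrow> real" and G :: "'b \<Rightarrow> real"
  assumes [measurable]: "F \<in> borel_measurable M" "G \<in> borel_measurable N"
    and F_nonneg: "\<And>x. 0 \<le> F x" and G_nonneg: "\<And>y. 0 \<le> G y"
    and nonneg: "0 \<le> a" "0 \<le> b" "0 \<le> c"
    and moments_F: "\<And>k. (\<integral>\<^sup>+x. ennreal (F x ^ k) \<partial>M) = ennreal (c ^ k * pochhammer a k)"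
    and moments_G: "\<And>k. (\<integral>\<^sup>+y. ennreal (G y ^ k) \<partial>N) = ennreal (c ^ k * pochhammer b k)"
  shows "(\<integral>\<^sup>+x. \<integral>\<^sup>+y. ennreal ((F x + G y) ^ k) \<partial>N \<partial>M) = ennreal (c ^ k * pochhammer (a + b) k)"
proof -
  have poch_nonneg: "0 \<le> pochhammer r l" if "0 \<le> r" for r :: real and l
    using that by (simp add: pochhammer_prod prod_nonneg)
  have binomial: "ennreal ((F x + G y) ^ k) =
      (\<Sum>l\<le>k. ennreal (real (k choose l) * F x ^ l) * ennreal (G y ^ (k - l)))" for x y
    using F_nonneg G_nonneg by (simp add: binomial_ring flip: ennreal_mult)
  have "(\<integral>\<^sup>+x. \<integral>\<^sup>+y. ennreal ((F x + G y) ^ k) \<partial>N \<partial>M) =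
      (\<integral>\<^sup>+x. (\<Sum>l\<le>k. ennreal (real (k choose l) * F x ^ l) *
        ennreal (c ^ (k - l) * pochhammer b (k - l))) \<partial>M)"
    unfolding binomial by (simp add: nn_integral_sum nn_integral_cmult moments_G)
  also have "\<dots> = (\<Sum>l\<le>k. ennreal (real (k choose l)) * ennreal (c ^ l * pochhammer a l) *
      ennreal (c ^ (k - l) * pochhammer b (k - l)))"
    using F_nonneg
    by (simp add: nn_integral_sum nn_integral_multc nn_integral_cmult ennreal_mult moments_F)
  also have "\<dots> = ennreal (\<Sum>l\<le>k. real (k choose l) * (c ^ l * pochhammer a l) *
      (c ^ (k - l) * pochhammer b (k - l)))"
    using nonneg by (simp add: poch_nonneg flip: ennreal_mult)
  also have "(\<Sum>l\<le>k. real (k choose l) * (c ^ l * pochhammer a l) *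
      (c ^ (k - l) * pochhammer b (k - l))) = c ^ k * pochhammer (a + b) k"
    unfolding pochhammer_binomial_sum sum_distrib_left
    by (intro sum.cong refl) (simp add: mult_ac flip: power_add)
  finally show ?thesis .
qed

lemma nn_integral_sum_squares_power:
  assumes "finite I"
  shows "(\<integral>\<^sup>+x. ennreal ((\<Sum>i\<in>I. (x i)\<^sup>2) ^ k) \<partial>(\<Pi>\<^sub>M i\<in>I. std_normal_distribution)) =
    ennreal (2 ^ k * pochhammer (real (card I) / 2) k)"
  using assms
proof (induction I arbitrary: k rule: finite_induct)
  case empty
  interpret prob_space "\<Pi>\<^sub>M i\<in>{}::'a set. std_normal_distribution"
    by (intro prob_space_PiM prob_space_std_normal_distribution)
  show ?case
    by (cases k) (simp_all add: pochhammer_0_left emeasure_space_1)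
next
  case (insert j I)
  interpret product_sigma_finite "\<lambda>_::'a. std_normal_distribution"
    by (simp add: product_sigma_finite_def prob_space_std_normal_distribution
        prob_space_imp_sigma_finite)
  have split_off: "(\<Sum>i\<in>insert j I. ((x(j := y)) i)\<^sup>2) = (\<Sum>i\<in>I. (x i)\<^sup>2) + y\<^sup>2" for x :: "'a \<Rightarrow> real" and y
    using insert.hyps by (simp add: add.commute) (intro sum.cong, auto)
  have "(\<integral>\<^sup>+x. ennreal ((\<Sum>i\<in>insert j I. (x i)\<^sup>2) ^ k) \<partial>(\<Pi>\<^sub>M i\<in>insert j I. std_normal_distribution)) =
      (\<integral>\<^sup>+x. \<integral>\<^sup>+y. ennreal (((\<Sum>i\<in>I. (x i)\<^sup>2) + y\<^sup>2) ^ k)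
        \<partial>std_normal_distribution \<partial>(\<Pi>\<^sub>M i\<in>I. std_normal_distribution))"
    unfolding split_off[symmetric] using insert.hyps by (intro product_nn_integral_insert) auto
  also have "\<dots> = ennreal (2 ^ k * pochhammer (real (card I) / 2 + 1 / 2) k)"
    by (rule nn_integral_add_power_pochhammer)
       (auto simp: insert.IH nn_integral_std_normal_even_power sum_nonneg simp flip: power_mult)
  also have "real (card I) / 2 + 1 / 2 = real (card (insert j I)) / 2"
    using insert.hyps by (simp add: field_simps)
  finally show ?case .
qed

lemma nn_integral_std_gaussian_norm_power:
  "(\<integral>\<^sup>+x. ennreal (norm x ^ (2 * k)) \<partial>(std_gaussian :: 'a::euclidean_space measure)) =
    ennreal (2 ^ k * pochhammer (real DIM('a) / 2) k)"
proof -
  have norm_eq: "norm (\<Sum>b\<in>Basis. f b *\<^sub>R b) ^ (2 * k) = (\<Sum>b\<in>Basis. (f b)\<^sup>2) ^ k" for f :: "'a \<Rightarrow> real"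
    unfolding power_mult power2_norm_eq_inner by (subst euclidean_inner) (simp add: power2_eq_square)
  show ?thesis
    unfolding std_gaussian_def by (simp add: nn_integral_distr norm_eq nn_integral_sum_squares_power)
qed

lemma indep_vars_PiM_component:
  assumes "\<And>i. i \<in> I \<Longrightarrow> prob_space (M i)" and "I \<noteq> {}"
  shows "prob_space.indep_vars (\<Pi>\<^sub>M i\<in>I. M i) M (\<lambda>i x. x i) I"
proof -
  interpret prob_space "\<Pi>\<^sub>M i\<in>I. M i"
    using assms(1) by (rule prob_space_PiM)
  have "distr (Pi\<^sub>M I M) (Pi\<^sub>M I M) (\<lambda>x. restrict x I) = distr (Pi\<^sub>M I M) (Pi\<^sub>M I M) (\<lambda>x. x)"
    by (intro distr_cong) (auto simp: space_PiM)
  moreover have "(\<Pi>\<^sub>M i\<in>I. distr (Pi\<^sub>M I M) (M i) (\<lambda>x. x i)) = Pi\<^sub>M I M"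
    using assms(1) by (intro PiM_cong refl distr_PiM_component) auto
  ultimately show ?thesis
    using assms(2) by (subst indep_vars_iff_distr_eq_PiM') auto
qed

lemma distributed_PiM_normal_sum:
  fixes c :: "'i \<Rightarrow> real"
  assumes "finite I" "j \<in> I" "c j \<noteq> 0"
  shows "distributed (\<Pi>\<^sub>M i\<in>I. std_normal_distribution) lborel (\<lambda>x. \<Sum>i\<in>I. c i * x i)
    (normal_density 0 (sqrt (\<Sum>i\<in>I. (c i)\<^sup>2)))"
proof -
  let ?P = "\<Pi>\<^sub>M i\<in>I. std_normal_distribution"
  interpret prob_space ?P
    by (intro prob_space_PiM prob_space_std_normal_distribution)
  define J where "J = {i \<in> I. c i \<noteq> 0}"
  have J_props: "finite J" "J \<noteq> {}" "J \<subseteq> I"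
    using assms by (auto simp: J_def)
  have "indep_vars (\<lambda>_. std_normal_distribution) (\<lambda>i x. x i) J"
    using J_props assms(2)
    by (intro indep_vars_subset[OF indep_vars_PiM_component] prob_space_std_normal_distribution) auto
  then have indep: "indep_vars (\<lambda>_. borel) (\<lambda>i x. c i * x i) J"
    by (rule indep_vars_compose2) auto
  have "distributed ?P lborel (\<lambda>x. x i) std_normal_density" if "i \<in> J" for i
  proof -
    have "distr ?P std_normal_distribution (\<lambda>x. x i) = std_normal_distribution"
      using that J_props by (intro distr_PiM_component prob_space_std_normal_distribution) auto
    then show ?thesis
      using that J_props by (auto simp: distributed_def cong: distr_cong)
  qed
  then have normal: "distributed ?P lborel (\<lambda>x. c i * x i) (normal_density 0 \<bar>c i\<bar>)" if "i \<in> J" for i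
    using normal_density_affine[of _ 0 1 "c i" 0] that by (auto simp: J_def)
  have "distributed ?P lborel (\<lambda>x. \<Sum>i\<in>J. c i * x i) (normal_density 0 (sqrt (\<Sum>i\<in>J. \<bar>c i\<bar>\<^sup>2)))"
    using sum_indep_normal[OF J_props(1,2) indep _ normal] by (auto simp: J_def)
  moreover have "(\<Sum>i\<in>J. c i * x i) = (\<Sum>i\<in>I. c i * x i)" for x
    unfolding J_def using assms(1) by (intro sum.mono_neutral_left) auto
  moreover have "(\<Sum>i\<in>J. \<bar>c i\<bar>\<^sup>2) = (\<Sum>i\<in>I. (c i)\<^sup>2)"
    unfolding J_def power2_abs using assms(1) by (intro sum.mono_neutral_left) auto
  ultimately show ?thesis
    by simp
qed

lemma distributed_std_gaussian_inner:
  fixes u :: "'a::euclidean_space"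
  assumes "u \<noteq> 0"
  shows "distributed std_gaussian lborel (\<lambda>x. u \<bullet> x) (normal_density 0 (norm u))"
proof -
  obtain b where b_props: "b \<in> Basis" "u \<bullet> b \<noteq> 0"
    using assms euclidean_all_zero_iff[of u] by auto
  have "norm u = sqrt (\<Sum>b\<in>Basis. (u \<bullet> b)\<^sup>2)"
    unfolding norm_eq_sqrt_inner by (subst euclidean_inner) (simp add: power2_eq_square)
  moreover have "u \<bullet> (\<Sum>b\<in>Basis. f b *\<^sub>R b) = (\<Sum>b\<in>Basis. (u \<bullet> b) * f b)" for f
    by (simp add: inner_sum_right mult.commute)
  ultimately show ?thesis
    using distributed_PiM_normal_sum[OF finite_Basis b_props(1), of "\<lambda>b. u \<bullet> b"] b_props(2)
    by (simp add: std_gaussian_def distributed_def distr_distr comp_def)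
qed

lemma nn_integral_std_gaussian_inner_power:
  "(\<integral>\<^sup>+x. ennreal ((u \<bullet> x) ^ (2 * k)) \<partial>std_gaussian) =
    ennreal (2 ^ k * pochhammer (1/2) k * norm u ^ (2 * k))"
proof (cases "u = 0")
  case True
  interpret prob_space std_gaussian
    by (rule prob_space_std_gaussian)
  show ?thesis
    using True by (cases k) (simp_all add: emeasure_space_1)
next
  case False
  have "fact (2 * k) / ((2 / (norm u)\<^sup>2) ^ k * fact k) = 2 ^ k * pochhammer (1/2) k * norm u ^ (2 * k)"
    using False by (simp add: power_divide power_mult flip: fact_double_div)
  then have "has_bochner_integral lborel (\<lambda>x. normal_density 0 (norm u) x * x ^ (2 * k))
      (2 ^ k * pochhammer (1/2) k * norm u ^ (2 * k))"
    using normal_moment_even[of "norm u" 0 k] False by simp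
  then have "(\<integral>\<^sup>+x. ennreal (normal_density 0 (norm u) x * x ^ (2 * k)) \<partial>lborel) =
      ennreal (2 ^ k * pochhammer (1/2) k * norm u ^ (2 * k))"
    by (subst nn_integral_eq_integral)
       (auto simp: has_bochner_integral_iff power_mult intro!: mult_nonneg_nonneg)
  moreover have "(\<integral>\<^sup>+x. ennreal ((u \<bullet> x) ^ (2 * k)) \<partial>std_gaussian) =
      (\<integral>\<^sup>+x. ennreal (normal_density 0 (norm u) x) * ennreal (x ^ (2 * k)) \<partial>lborel)"
    by (rule distributed_nn_integral[OF distributed_std_gaussian_inner[OF False], symmetric]) auto
  ultimately show ?thesis
    by (simp add: ennreal_mult power_mult)
qed

lemma (in sigma_finite_measure) nn_integral_norm_power_le_directional:
  fixes Y :: "'a \<Rightarrow> 'b::euclidean_space"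
  assumes [measurable]: "Y \<in> borel_measurable M" and "0 \<le> C"
    and directional: "\<And>u. (\<integral>\<^sup>+\<omega>. ennreal ((u \<bullet> Y \<omega>) ^ (2 * k)) \<partial>M) \<le> ennreal (C * norm u ^ (2 * k))"
  shows "(\<integral>\<^sup>+\<omega>. ennreal (norm (Y \<omega>) ^ (2 * k)) \<partial>M) \<le>
    ennreal (C * pochhammer (real DIM('b) / 2) k / pochhammer (1/2) k)"
proof -
  interpret gaussian: prob_space "std_gaussian :: 'b measure"
    by (rule prob_space_std_gaussian)
  interpret pair_sigma_finite M "std_gaussian :: 'b measure" ..
  let ?c = "2 ^ k * pochhammer (1/2) k :: real"
  have c_pos: "0 < ?c"
    by (simp add: pochhammer_pos)
  have "ennreal ?c * (\<integral>\<^sup>+\<omega>. ennreal (norm (Y \<omega>) ^ (2 * k)) \<partial>M) =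
      (\<integral>\<^sup>+\<omega>. \<integral>\<^sup>+x. ennreal ((x \<bullet> Y \<omega>) ^ (2 * k)) \<partial>std_gaussian \<partial>M)"
    using c_pos by (simp add: nn_integral_std_gaussian_inner_power nn_integral_cmult ennreal_mult
        inner_commute[of _ "Y _"])
  also have "\<dots> = (\<integral>\<^sup>+x. \<integral>\<^sup>+\<omega>. ennreal ((x \<bullet> Y \<omega>) ^ (2 * k)) \<partial>M \<partial>std_gaussian)"
    by (rule Fubini'[symmetric]) measurable
  also have "\<dots> \<le> (\<integral>\<^sup>+x. ennreal (C * norm x ^ (2 * k)) \<partial>(std_gaussian :: 'b measure))"
    by (intro nn_integral_mono directional)
  also have "\<dots> = ennreal C * ennreal (2 ^ k * pochhammer (real DIM('b) / 2) k)"
    using \<open>0 \<le> C\<close> by (simp add: ennreal_mult nn_integral_cmult nn_integral_std_gaussian_norm_power)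
  also have "\<dots> = ennreal ?c * ennreal (C * pochhammer (real DIM('b) / 2) k / pochhammer (1/2) k)"
    using c_pos \<open>0 \<le> C\<close> pochhammer_pos[of "1/2 :: real" k]
    by (simp add: field_simps pochhammer_nonneg flip: ennreal_mult)
  finally show ?thesis
    using c_pos by (subst (asm) ennreal_mult_le_mult_iff) (auto simp: ennreal_zero_less_mult_iff)
qed

section \<open>Deviations of a locally sub-Gaussian vector\<close>

lemma pochhammer_le_mean_power:
  fixes a :: real
  assumes "0 \<le> a" "0 < k"
  shows "pochhammer a k \<le> (a + (real k - 1) / 2) ^ k"
proof -
  have pochhammer_eq: "pochhammer a k = (\<Prod>i<k. a + real i)"
    by (simp add: pochhammer_prod atLeast0LessThan)
  have "0 \<le> pochhammer a k"
    using assms(1) by (simp add: pochhammer_eq prod_nonneg)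
  then have "pochhammer a k = (pochhammer a k powr (1 / real k)) ^ k"
    using assms(2) by (cases "pochhammer a k = 0") (simp_all add: powr_power zero_power)
  also have "\<dots> \<le> (\<Sum>i<k. (a + real i) / real k) ^ k"
    using arith_geom_mean[of "{..<k}" "\<lambda>i. a + real i"] assms
    unfolding pochhammer_eq by (intro power_mono) auto
  also have "(\<Sum>i<k. (a + real i) / real k) = a + (real k - 1) / 2"
    using double_arith_series[of a 1 "k - 1"] assms(2)
    by (simp add: atLeast0AtMost lessThan_Suc_atMost[symmetric] of_nat_diff field_simps
        flip: sum_divide_distrib)
  finally show ?thesis .
qed

lemma fact_le_half_power:
  assumes "0 < k"
  shows "fact k \<le> 2 * (real k / 2) ^ k"
proof (cases "k = 1")
  case False
  then obtain m where k_eq: "k = Suc m" and "0 < m"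
    using assms by (cases k) auto
  have "fact k = real k * pochhammer 1 m"
    by (simp add: k_eq flip: pochhammer_fact)
  also have "\<dots> \<le> real k * (real k / 2) ^ m"
    using pochhammer_le_mean_power[of 1 m] \<open>0 < m\<close>
    by (intro mult_left_mono) (auto simp: k_eq field_simps)
  also have "\<dots> = 2 * (real k / 2) ^ k"
    by (simp add: k_eq)
  finally show ?thesis .
qed simp

lemma sum_even_powers_le_cosh:
  fixes x :: real
  assumes "finite I"
  shows "(\<Sum>k\<in>I. x ^ (2 * k) / fact (2 * k)) \<le> cosh x"
proof -
  let ?c = "\<lambda>n. if even n then x ^ n / fact n else 0"
  have cosh_sums: "?c sums cosh x"
    using cosh_converges[of x] by (simp add: divide_inverse mult.commute cong: if_cong)
  have "(\<Sum>k\<in>I. x ^ (2 * k) / fact (2 * k)) = (\<Sum>n\<in>(*) 2 ` I. ?c n)"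
    by (subst sum.reindex) (auto simp: inj_on_def)
  also have "\<dots> \<le> cosh x"
    unfolding sums_unique[OF cosh_sums] using assms
    by (intro sum_le_suminf[OF sums_summable[OF cosh_sums]]) (auto elim!: evenE simp: power_mult)
  finally show ?thesis .
qed

definition (in prob_space) locally_subgaussian ::
    "('a \<Rightarrow> 'b::euclidean_space) \<Rightarrow> real \<Rightarrow> real \<Rightarrow> bool" where
  "locally_subgaussian Y \<nu> g \<longleftrightarrow> Y \<in> borel_measurable M \<and>
     (\<forall>v. norm v \<le> g \<longrightarrow> integrable M (\<lambda>\<omega>. exp (v \<bullet> Y \<omega>)) \<and>
       expectation (\<lambda>\<omega>. exp (v \<bullet> Y \<omega>)) \<le> exp (\<nu>\<^sup>2 * (norm v)\<^sup>2 / 2))"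

lemma (in prob_space) locally_subgaussian_cosh:
  assumes "locally_subgaussian Y \<nu> g" "norm v \<le> g"
  shows "integrable M (\<lambda>\<omega>. cosh (v \<bullet> Y \<omega>))"
    and "expectation (\<lambda>\<omega>. cosh (v \<bullet> Y \<omega>)) \<le> exp (\<nu>\<^sup>2 * (norm v)\<^sup>2 / 2)"
proof -
  have integrable_exp: "integrable M (\<lambda>\<omega>. exp (v \<bullet> Y \<omega>))" "integrable M (\<lambda>\<omega>. exp ((- v) \<bullet> Y \<omega>))"
    and mgf_le: "expectation (\<lambda>\<omega>. exp (v \<bullet> Y \<omega>)) \<le> exp (\<nu>\<^sup>2 * (norm v)\<^sup>2 / 2)"
      "expectation (\<lambda>\<omega>. exp ((- v) \<bullet> Y \<omega>)) \<le> exp (\<nu>\<^sup>2 * (norm (- v))\<^sup>2 / 2)"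
    using assms unfolding locally_subgaussian_def by (metis norm_minus_cancel)+
  have cosh_eq: "cosh (v \<bullet> Y \<omega>) = (exp (v \<bullet> Y \<omega>) + exp ((- v) \<bullet> Y \<omega>)) / 2" for \<omega>
    by (simp add: cosh_field_def)
  show "integrable M (\<lambda>\<omega>. cosh (v \<bullet> Y \<omega>))"
    unfolding cosh_eq using integrable_exp
    by (intro integrable_divide Bochner_Integration.integrable_add)
  show "expectation (\<lambda>\<omega>. cosh (v \<bullet> Y \<omega>)) \<le> exp (\<nu>\<^sup>2 * (norm v)\<^sup>2 / 2)"
    unfolding cosh_eq using integrable_exp mgf_le by simp
qed

lemma (in prob_space) locally_subgaussian_inner_power_le:
  assumes Y: "locally_subgaussian Y \<nu> g" and l_range: "0 < l" "l \<le> g"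
  shows "(\<integral>\<^sup>+\<omega>. ennreal ((u \<bullet> Y \<omega>) ^ (2 * k)) \<partial>M) \<le>
    ennreal (fact (2 * k) * exp (\<nu>\<^sup>2 * l\<^sup>2 / 2) / l ^ (2 * k) * norm u ^ (2 * k))"
proof (cases "u = 0")
  case True
  then show ?thesis
    by (cases k) (simp_all add: emeasure_space_1)
next
  case False
  define v where "v = (l / norm u) *\<^sub>R u"
  define c where "c = fact (2 * k) / l ^ (2 * k) * norm u ^ (2 * k)"
  have norm_v: "norm v = l"
    using False l_range by (simp add: v_def)
  note cosh = locally_subgaussian_cosh[OF Y, of v, unfolded norm_v, OF l_range(2)]
  have c_nonneg: "0 \<le> c"
    using l_range by (simp add: c_def)
  have le_cosh: "(u \<bullet> Y \<omega>) ^ (2 * k) \<le> c * cosh (v \<bullet> Y \<omega>)" for \<omega>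
  proof -
    have "(u \<bullet> Y \<omega>) ^ (2 * k) = c * ((v \<bullet> Y \<omega>) ^ (2 * k) / fact (2 * k))"
      using False l_range by (simp add: c_def v_def power_mult_distrib power_divide)
    then show ?thesis
      using mult_left_mono[OF sum_even_powers_le_cosh[of "{k}" "v \<bullet> Y \<omega>"] c_nonneg] by simp
  qed
  have "(\<integral>\<^sup>+\<omega>. ennreal ((u \<bullet> Y \<omega>) ^ (2 * k)) \<partial>M) \<le> (\<integral>\<^sup>+\<omega>. ennreal (c * cosh (v \<bullet> Y \<omega>)) \<partial>M)"
    by (intro nn_integral_mono ennreal_leI le_cosh)
  also have "\<dots> = ennreal (c * expectation (\<lambda>\<omega>. cosh (v \<bullet> Y \<omega>)))"
    using cosh(1) c_nonneg by (subst nn_integral_eq_integral) auto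
  also have "\<dots> \<le> ennreal (c * exp (\<nu>\<^sup>2 * l\<^sup>2 / 2))"
    using cosh(2) c_nonneg by (intro ennreal_leI mult_left_mono)
  finally show ?thesis
    by (simp add: c_def mult_ac)
qed

lemma (in prob_space) locally_subgaussian_norm_power_le_pochhammer:
  fixes Y :: "'a \<Rightarrow> 'b::euclidean_space"
  assumes Y: "locally_subgaussian Y \<nu> g" and pos: "0 < \<nu>" "0 \<le> g" "0 < k"
    and k_le: "2 * real k \<le> (\<nu> * g)\<^sup>2"
  shows "(\<integral>\<^sup>+\<omega>. ennreal (norm (Y \<omega>) ^ (2 * k)) \<partial>M) \<le>
    ennreal (fact k * pochhammer (real DIM('b) / 2) k * (2 * exp 1 * \<nu>\<^sup>2 / real k) ^ k)"
proof -
  \<comment> \<open>the minimizer of \<open>exp (\<nu>\<^sup>2 * l\<^sup>2 / 2) / l ^ (2 * k)\<close>\<close>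
  define l where "l = sqrt (2 * real k) / \<nu>"
  define C where "C = fact (2 * k) * exp (\<nu>\<^sup>2 * l\<^sup>2 / 2) / l ^ (2 * k)"
  have l_sq: "l\<^sup>2 = 2 * real k / \<nu>\<^sup>2"
    by (simp add: l_def power_divide)
  have "sqrt (2 * real k) \<le> \<nu> * g"
    using k_le pos by (intro real_le_lsqrt) auto
  then have l_range: "0 < l" "l \<le> g"
    using pos by (simp_all add: l_def divide_le_eq mult.commute)
  have "C = fact (2 * k) * exp 1 ^ k / (2 * real k / \<nu>\<^sup>2) ^ k"
    using pos by (simp add: C_def power_mult l_sq flip: exp_of_nat_mult)
  also have "\<dots> = pochhammer (1/2) k * (fact k * (2 * exp 1 * \<nu>\<^sup>2 / real k) ^ k)"
    unfolding fact_double using pos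
    by (simp add: power_mult_distrib power_divide power_mult power2_eq_square field_simps)
  finally have C_eq: "C = pochhammer (1/2) k * (fact k * (2 * exp 1 * \<nu>\<^sup>2 / real k) ^ k)" .
  have "(\<integral>\<^sup>+\<omega>. ennreal (norm (Y \<omega>) ^ (2 * k)) \<partial>M) \<le>
      ennreal (C * pochhammer (real DIM('b) / 2) k / pochhammer (1/2) k)"
  proof (rule nn_integral_norm_power_le_directional)
    show "(\<integral>\<^sup>+\<omega>. ennreal ((u \<bullet> Y \<omega>) ^ (2 * k)) \<partial>M) \<le> ennreal (C * norm u ^ (2 * k))" for u
      unfolding C_def by (rule locally_subgaussian_inner_power_le[OF Y l_range])
  qed (use Y in \<open>auto simp: C_def locally_subgaussian_def\<close>)
  also have "C * pochhammer (real DIM('b) / 2) k / pochhammer (1/2) k =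
      fact k * pochhammer (real DIM('b) / 2) k * (2 * exp 1 * \<nu>\<^sup>2 / real k) ^ k"
    using pochhammer_pos[of "1/2 :: real" k] by (simp add: C_eq)
  finally show ?thesis .
qed

lemma (in prob_space) locally_subgaussian_norm_power_le:
  fixes Y :: "'a \<Rightarrow> 'b::euclidean_space"
  assumes Y: "locally_subgaussian Y \<nu> g" and pos: "0 < \<nu>" "0 \<le> g" "0 < k"
    and "2 * real k \<le> (\<nu> * g)\<^sup>2"
  shows "(\<integral>\<^sup>+\<omega>. ennreal (norm (Y \<omega>) ^ (2 * k)) \<partial>M) \<le>
    ennreal (2 * (exp 1 / 2 * \<nu>\<^sup>2 * (real DIM('b) + real k)) ^ k)"
proof -
  let ?d = "real DIM('b)"
  have "pochhammer (?d / 2) k \<le> (?d / 2 + (real k - 1) / 2) ^ k"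
    using pos by (intro pochhammer_le_mean_power) auto
  also have "\<dots> \<le> ((?d + real k) / 2) ^ k"
    using pos DIM_positive[where 'a = 'b] by (intro power_mono) (auto simp: field_simps)
  finally have "pochhammer (?d / 2) k \<le> ((?d + real k) / 2) ^ k" .
  then have "fact k * pochhammer (?d / 2) k * (2 * exp 1 * \<nu>\<^sup>2 / real k) ^ k \<le>
      (2 * (real k / 2) ^ k) * ((?d + real k) / 2) ^ k * (2 * exp 1 * \<nu>\<^sup>2 / real k) ^ k"
    using fact_le_half_power[OF \<open>0 < k\<close>]
    by (intro mult_right_mono mult_mono) (auto intro!: pochhammer_nonneg)
  also have "\<dots> = 2 * (exp 1 / 2 * \<nu>\<^sup>2 * (?d + real k)) ^ k"
    using pos by (simp add: mult.assoc flip: power_mult_distrib)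
  finally show ?thesis
    by (intro order_trans[OF locally_subgaussian_norm_power_le_pochhammer[OF assms]] ennreal_leI)
qed

lemma (in prob_space) prob_norm_ge_le_moment:
  fixes Y :: "'a \<Rightarrow> 'b::real_normed_vector"
  assumes [measurable]: "Y \<in> borel_measurable M" and "0 < t" "0 \<le> c"
    and moment: "(\<integral>\<^sup>+\<omega>. ennreal (norm (Y \<omega>) ^ m) \<partial>M) \<le> ennreal c"
  shows "prob {\<omega> \<in> space M. t \<le> norm (Y \<omega>)} \<le> c / t ^ m"
proof -
  have "emeasure M {\<omega> \<in> space M. t \<le> norm (Y \<omega>)} \<le>
      emeasure M {\<omega> \<in> space M. 1 \<le> ennreal (1 / t ^ m) * ennreal (norm (Y \<omega>) ^ m)}"
    using \<open>0 < t\<close> by (intro emeasure_mono) (auto simp flip: ennreal_mult ennreal_1 intro!: power_mono)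
  also have "\<dots> \<le> ennreal (1 / t ^ m) * (\<integral>\<^sup>+\<omega>. ennreal (norm (Y \<omega>) ^ m) * indicator (space M) \<omega> \<partial>M)"
    by (rule nn_integral_Markov_inequality) auto
  also have "(\<integral>\<^sup>+\<omega>. ennreal (norm (Y \<omega>) ^ m) * indicator (space M) \<omega> \<partial>M) =
      (\<integral>\<^sup>+\<omega>. ennreal (norm (Y \<omega>) ^ m) \<partial>M)"
    by (rule nn_integral_cong) simp
  also have "ennreal (1 / t ^ m) * \<dots> \<le> ennreal (1 / t ^ m) * ennreal c"
    by (intro mult_left_mono moment) simp
  also have "\<dots> = ennreal (c / t ^ m)"
    using \<open>0 < t\<close> \<open>0 \<le> c\<close> by (simp flip: ennreal_mult)
  finally show ?thesis
    using \<open>0 < t\<close> \<open>0 \<le> c\<close> by (simp add: emeasure_eq_measure)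
qed

lemma (in prob_space) locally_subgaussian_prob_norm_ge:
  fixes Y :: "'a \<Rightarrow> 'b::euclidean_space"
  assumes Y: "locally_subgaussian Y \<nu> g" and pos: "0 < \<nu>" "0 \<le> g" "0 < k"
    and k_le: "2 * real k \<le> (\<nu> * g)\<^sup>2"
    and t_range: "0 < t" "4 * \<nu>\<^sup>2 * (real DIM('b) + real k) \<le> t\<^sup>2"
  shows "prob {\<omega> \<in> space M. t \<le> norm (Y \<omega>)} \<le> 2 * exp (- real k)"
proof -
  let ?d = "real DIM('b)"
  have "prob {\<omega> \<in> space M. t \<le> norm (Y \<omega>)} \<le> 2 * (exp 1 / 2 * \<nu>\<^sup>2 * (?d + real k)) ^ k / t ^ (2 * k)"
    using Y t_range locally_subgaussian_norm_power_le[OF Y pos k_le]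
    by (intro prob_norm_ge_le_moment) (auto simp: locally_subgaussian_def)
  also have "\<dots> = 2 * (exp 1 / 8 * (4 * \<nu>\<^sup>2 * (?d + real k) / t\<^sup>2)) ^ k"
    by (simp add: power_mult power_mult_distrib power_divide)
  also have "\<dots> \<le> 2 * (exp (- 1)) ^ k"
  proof (intro mult_left_mono power_mono)
    have "exp 1 * exp 1 \<le> (272/100) * (272/100 :: real)"
      using e_less_272 by (intro mult_mono) auto
    then have "exp 1 / 8 \<le> exp (- 1 :: real)"
      by (simp add: exp_minus field_simps)
    then have "exp 1 / 8 * (4 * \<nu>\<^sup>2 * (?d + real k) / t\<^sup>2) \<le> exp (- 1) * 1"
      using t_range by (intro mult_mono) auto
    then show "exp 1 / 8 * (4 * \<nu>\<^sup>2 * (?d + real k) / t\<^sup>2) \<le> exp (- 1)"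
      by simp
  qed auto
  also have "\<dots> = 2 * exp (- real k)"
    by (simp flip: exp_of_nat_mult)
  finally show ?thesis .
qed

lemma (in prob_space) locally_subgaussian_deviation_bound:
  fixes Y :: "'a \<Rightarrow> 'b::euclidean_space"
  assumes Y: "locally_subgaussian Y \<nu> g" and "1 \<le> \<nu>" "0 \<le> g" and z_range: "0 \<le> z" "z \<le> g\<^sup>2 / 4"
  shows "prob {\<omega> \<in> space M. 2 * \<nu> * (sqrt (real DIM('b)) + sqrt (2 * z)) \<le> norm (Y \<omega>)} \<le> 2 * exp (- z)"
proof (cases "z < 1 / 2")
  case True
  then have "1 \<le> 2 * exp (- z)"
    using exp_ge_add_one_self[of "- z"] by linarith
  then show ?thesis
    by (rule order_trans[OF prob_le_1])
next
  case False
  define k where "k = nat \<lfloor>2 * z\<rfloor>"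
  have k_bounds: "0 < k" "real k \<le> 2 * z" "2 * z < real k + 1"
    using False unfolding k_def by linarith+
  have "2 * real k \<le> g\<^sup>2"
    using k_bounds z_range by linarith
  also have "\<dots> \<le> (\<nu> * g)\<^sup>2"
    using \<open>1 \<le> \<nu>\<close> \<open>0 \<le> g\<close> mult_right_mono[of 1 \<nu> g] by (intro power_mono) auto
  finally have k_le: "2 * real k \<le> (\<nu> * g)\<^sup>2" .
  let ?t = "2 * \<nu> * (sqrt (real DIM('b)) + sqrt (2 * z))"
  have "real DIM('b) + real k \<le> (sqrt (real DIM('b)) + sqrt (2 * z))\<^sup>2"
    using k_bounds(2) z_range by (auto simp: power2_sum intro: order_trans)
  then have "4 * \<nu>\<^sup>2 * (real DIM('b) + real k) \<le> ?t\<^sup>2"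
    by (simp add: power_mult_distrib mult_left_mono)
  then have "prob {\<omega> \<in> space M. ?t \<le> norm (Y \<omega>)} \<le> 2 * exp (- real k)"
    using \<open>1 \<le> \<nu>\<close> \<open>0 \<le> g\<close> z_range k_bounds(1)
    by (intro locally_subgaussian_prob_norm_ge[OF Y _ _ _ k_le])
       (auto intro!: mult_pos_pos add_pos_nonneg)
  also have "\<dots> \<le> 2 * exp (- z)"
    using k_bounds by simp
  finally show ?thesis .
qed

lemma one_plus_scaled_inner_square_le_cosh:
  fixes u y :: "'a::real_inner"
  shows "1 + s\<^sup>2 / 2 * (u \<bullet> y)\<^sup>2 \<le> cosh ((s *\<^sub>R u) \<bullet> y)"
  using sum_even_powers_le_cosh[of "{0, 1}" "(s *\<^sub>R u) \<bullet> y"]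
  by (simp add: power_mult_distrib numeral_2_eq_2)

lemma (in prob_space) locally_subgaussian_integrable_inner_square:
  assumes Y: "locally_subgaussian Y \<nu> g" and "0 < s" "norm (s *\<^sub>R u) \<le> g"
  shows "integrable M (\<lambda>\<omega>. (u \<bullet> Y \<omega>)\<^sup>2)"
proof (rule Bochner_Integration.integrable_bound)
  have [measurable]: "Y \<in> borel_measurable M"
    using Y by (simp add: locally_subgaussian_def)
  show "(\<lambda>\<omega>. (u \<bullet> Y \<omega>)\<^sup>2) \<in> borel_measurable M"
    by measurable
  show "integrable M (\<lambda>\<omega>. 2 / s\<^sup>2 * cosh ((s *\<^sub>R u) \<bullet> Y \<omega>))"
    using assms by (intro integrable_mult_right locally_subgaussian_cosh(1)[OF Y])
  have "(u \<bullet> Y \<omega>)\<^sup>2 \<le> 2 / s\<^sup>2 * cosh ((s *\<^sub>R u) \<bullet> Y \<omega>)" for \<omega>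
    using one_plus_scaled_inner_square_le_cosh[of s u "Y \<omega>"] \<open>0 < s\<close> by (simp add: field_simps)
  then show "AE \<omega> in M. norm ((u \<bullet> Y \<omega>)\<^sup>2) \<le> norm (2 / s\<^sup>2 * cosh ((s *\<^sub>R u) \<bullet> Y \<omega>))"
    by (intro AE_I2) (simp add: abs_mult)
qed

lemma (in prob_space) locally_subgaussian_second_moment_le:
  assumes Y: "locally_subgaussian Y \<nu> g" and "0 < g"
  shows "expectation (\<lambda>\<omega>. (u \<bullet> Y \<omega>)\<^sup>2) \<le> \<nu>\<^sup>2 * (norm u)\<^sup>2"
proof -
  let ?m = "expectation (\<lambda>\<omega>. (u \<bullet> Y \<omega>)\<^sup>2)"
  define s\<^sub>0 where "s\<^sub>0 = g / (norm u + 1)"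
  have "0 < norm u + 1"
    by (simp add: add_nonneg_pos)
  then have s\<^sub>0_pos: "0 < s\<^sub>0" and s\<^sub>0_mult: "s\<^sub>0 * (norm u + 1) = g"
    using \<open>0 < g\<close> by (simp_all add: s\<^sub>0_def)
  have small: "norm (s *\<^sub>R u) \<le> g" if "0 < s" "s \<le> s\<^sub>0" for s
  proof -
    have "norm (s *\<^sub>R u) \<le> s\<^sub>0 * (norm u + 1)"
      using that s\<^sub>0_pos by (simp add: mult_mono)
    then show ?thesis
      unfolding s\<^sub>0_mult .
  qed
  have integrable_square: "integrable M (\<lambda>\<omega>. (u \<bullet> Y \<omega>)\<^sup>2)"
    using locally_subgaussian_integrable_inner_square[OF Y s\<^sub>0_pos small] s\<^sub>0_pos by simp
  have "1 + s\<^sup>2 / 2 * ?m \<le> exp (\<nu>\<^sup>2 * (norm u)\<^sup>2 * s\<^sup>2 / 2)" if "0 < s" "s \<le> s\<^sub>0" for s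
  proof -
    note cosh = locally_subgaussian_cosh[OF Y small[OF that]]
    have "1 + s\<^sup>2 / 2 * ?m = expectation (\<lambda>\<omega>. 1 + s\<^sup>2 / 2 * (u \<bullet> Y \<omega>)\<^sup>2)"
      using integrable_square by (simp add: prob_space)
    also have "\<dots> \<le> expectation (\<lambda>\<omega>. cosh ((s *\<^sub>R u) \<bullet> Y \<omega>))"
      using integrable_square cosh(1) by (intro integral_mono one_plus_scaled_inner_square_le_cosh) auto
    finally show ?thesis
      using cosh(2) by (simp add: power_mult_distrib mult_ac)
  qed
  then have "eventually (\<lambda>s. ?m \<le> (exp (\<nu>\<^sup>2 * (norm u)\<^sup>2 * s\<^sup>2 / 2) - 1) / (s\<^sup>2 / 2)) (at_right 0)"
    using s\<^sub>0_pos unfolding eventually_at_right_field by (intro exI[of _ s\<^sub>0]) (auto simp: field_simps)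
  moreover have "((\<lambda>s. (exp (c * s\<^sup>2 / 2) - 1) / (s\<^sup>2 / 2)) \<longlongrightarrow> c) (at_right 0)" for c :: real
    by real_asymp
  ultimately show ?thesis
    by (intro tendsto_lowerbound) auto
qed

section \<open>Exponential integrals of a bounded statistic\<close>

locale bounded_statistic = finite_measure N
  for N :: "'a measure" +
  fixes \<Psi> :: "'a \<Rightarrow> 'b::euclidean_space"
  assumes measurable_statistic [measurable]: "\<Psi> \<in> borel_measurable N"
    and statistic_bounded: "\<exists>B. \<forall>t. norm (\<Psi> t) \<le> B"
begin

lemma integrable_continuous_statistic:
  fixes \<phi> :: "'b \<Rightarrow> 'c::{banach,second_countable_topology}"
  assumes "continuous_on UNIV \<phi>"
  shows "integrable N (\<lambda>t. \<phi> (\<Psi> t))"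
proof -
  obtain B where B: "\<And>t. norm (\<Psi> t) \<le> B"
    using statistic_bounded by blast
  have "bounded (\<phi> ` cball 0 B)"
    by (intro compact_imp_bounded compact_continuous_image continuous_on_subset[OF assms]) auto
  then obtain C where "\<And>x. x \<in> cball 0 B \<Longrightarrow> norm (\<phi> x) \<le> C"
    unfolding bounded_iff by blast
  then have "norm (\<phi> (\<Psi> t)) \<le> C" for t
    using B by simp
  then show ?thesis
    using borel_measurable_continuous_onI[OF assms] by (intro integrable_const_bound[of _ C]) auto
qed

lemma norm_integral_exp_remainder_le:
  fixes \<phi> :: "'b \<Rightarrow> 'c::{banach,second_countable_topology}"
  assumes \<phi>: "continuous_on UNIV \<phi>" and B: "\<And>t. norm (\<Psi> t) \<le> B" and norm_v_le: "norm v \<le> 1"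
  shows "norm (\<integral>t. (exp (\<Psi> t \<bullet> v) - 1 - \<Psi> t \<bullet> v) *\<^sub>R \<phi> (\<Psi> t) \<partial>N) \<le>
    exp B * (B * norm v)\<^sup>2 * (\<integral>t. norm (\<phi> (\<Psi> t)) \<partial>N)"
proof -
  have pointwise: "norm ((exp (\<Psi> t \<bullet> v) - 1 - \<Psi> t \<bullet> v) *\<^sub>R \<phi> (\<Psi> t)) \<le>
      exp B * (B * norm v)\<^sup>2 * norm (\<phi> (\<Psi> t))" for t
  proof -
    have inner_le: "\<bar>\<Psi> t \<bullet> v\<bar> \<le> B * norm v"
      using B[of t] by (meson Cauchy_Schwarz_ineq2 mult_right_mono norm_ge_zero order_trans)
    also have "\<dots> \<le> B"
      using norm_v_le order_trans[OF norm_ge_zero B] by (simp add: mult_left_le)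
    finally have "exp \<bar>\<Psi> t \<bullet> v\<bar> * \<bar>\<Psi> t \<bullet> v\<bar>\<^sup>2 \<le> exp B * (B * norm v)\<^sup>2"
      using inner_le by (intro mult_mono power_mono) auto
    then have "\<bar>exp (\<Psi> t \<bullet> v) - 1 - \<Psi> t \<bullet> v\<bar> \<le> exp B * (B * norm v)\<^sup>2"
      using Taylor_exp_field[of "\<Psi> t \<bullet> v" 1] by (simp add: power2_eq_square algebra_simps)
    then show ?thesis
      by (simp add: mult_right_mono)
  qed
  have "norm (\<integral>t. (exp (\<Psi> t \<bullet> v) - 1 - \<Psi> t \<bullet> v) *\<^sub>R \<phi> (\<Psi> t) \<partial>N) \<le>
      (\<integral>t. norm ((exp (\<Psi> t \<bullet> v) - 1 - \<Psi> t \<bullet> v) *\<^sub>R \<phi> (\<Psi> t)) \<partial>N)"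
    by (rule integral_norm_bound)
  also have "\<dots> \<le> (\<integral>t. exp B * (B * norm v)\<^sup>2 * norm (\<phi> (\<Psi> t)) \<partial>N)"
    using \<phi> by (intro integral_mono pointwise integrable_mult_right integrable_norm
        integrable_continuous_statistic continuous_intros)
  finally show ?thesis
    by simp
qed

lemma has_derivative_integral_exp_inner_at_0:
  fixes \<phi> :: "'b \<Rightarrow> 'c::{banach,second_countable_topology}"
  assumes \<phi>: "continuous_on UNIV \<phi>"
  shows "((\<lambda>\<theta>. \<integral>t. exp (\<Psi> t \<bullet> \<theta>) *\<^sub>R \<phi> (\<Psi> t) \<partial>N) has_derivative
    (\<lambda>v. \<integral>t. (\<Psi> t \<bullet> v) *\<^sub>R \<phi> (\<Psi> t) \<partial>N)) (at 0)"
proof -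
  let ?f = "\<lambda>\<theta>. \<integral>t. exp (\<Psi> t \<bullet> \<theta>) *\<^sub>R \<phi> (\<Psi> t) \<partial>N"
    and ?f' = "\<lambda>v. \<integral>t. (\<Psi> t \<bullet> v) *\<^sub>R \<phi> (\<Psi> t) \<partial>N"
  obtain B where B: "\<And>t. norm (\<Psi> t) \<le> B"
    using statistic_bounded by blast
  have integrable_terms: "integrable N (\<lambda>t. \<phi> (\<Psi> t))" "integrable N (\<lambda>t. exp (\<Psi> t \<bullet> v) *\<^sub>R \<phi> (\<Psi> t))"
      "integrable N (\<lambda>t. (\<Psi> t \<bullet> v) *\<^sub>R \<phi> (\<Psi> t))" for v
    using \<phi> by (auto intro!: integrable_continuous_statistic continuous_intros)
  have "linear ?f'"
    using integrable_terms
    by (intro linearI) (simp_all add: inner_add_right scaleR_left_distrib flip: scaleR_scaleR)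
  define C where "C = exp B * B\<^sup>2 * (\<integral>t. norm (\<phi> (\<Psi> t)) \<partial>N)"
  have remainder: "norm (?f v - ?f 0 - ?f' v) \<le> C * (norm v)\<^sup>2" if "norm v \<le> 1" for v
  proof -
    have "?f v - ?f 0 - ?f' v = (\<integral>t. (exp (\<Psi> t \<bullet> v) - 1 - \<Psi> t \<bullet> v) *\<^sub>R \<phi> (\<Psi> t) \<partial>N)"
      using integrable_terms by (simp add: scaleR_left_diff_distrib)
    then show ?thesis
      using norm_integral_exp_remainder_le[OF \<phi> B that] by (simp add: C_def power_mult_distrib mult_ac)
  qed
  show ?thesis
  proof (rule has_derivativeI_sandwich[where e = 1 and H = "\<lambda>v. C * norm v"])
    show "bounded_linear ?f'"
      using \<open>linear ?f'\<close> by (simp add: linear_conv_bounded_linear)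
    show "((\<lambda>v. C * norm v) \<longlongrightarrow> 0) (at 0)"
      by (auto intro!: tendsto_eq_intros)
    show "norm (?f v - ?f 0 - ?f' (v - 0)) / norm (v - 0) \<le> C * norm v" if "v \<noteq> 0" "dist v 0 < 1" for v
      using remainder[of v] that by (simp add: divide_le_eq power2_eq_square mult.assoc)
  qed simp
qed

lemma has_derivative_integral_exp_inner:
  fixes \<phi> :: "'b \<Rightarrow> 'c::{banach,second_countable_topology}"
  assumes \<phi>: "continuous_on UNIV \<phi>"
  shows "((\<lambda>\<theta>. \<integral>t. exp (\<Psi> t \<bullet> \<theta>) *\<^sub>R \<phi> (\<Psi> t) \<partial>N) has_derivative
    (\<lambda>v. \<integral>t. (exp (\<Psi> t \<bullet> \<theta>) * (\<Psi> t \<bullet> v)) *\<^sub>R \<phi> (\<Psi> t) \<partial>N)) (at \<theta>)"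
proof -
  have "continuous_on UNIV (\<lambda>x. exp (x \<bullet> \<theta>) *\<^sub>R \<phi> x)"
    using \<phi> by (intro continuous_intros)
  note at_0 = has_derivative_integral_exp_inner_at_0[OF this]
  have "((\<lambda>\<eta>. \<eta> - \<theta>) has_derivative (\<lambda>v. v)) (at \<theta>)"
    by (auto intro!: derivative_eq_intros)
  then have "((\<lambda>\<eta>. \<integral>t. exp (\<Psi> t \<bullet> (\<eta> - \<theta>)) *\<^sub>R exp (\<Psi> t \<bullet> \<theta>) *\<^sub>R \<phi> (\<Psi> t) \<partial>N) has_derivative
      (\<lambda>v. \<integral>t. (\<Psi> t \<bullet> v) *\<^sub>R exp (\<Psi> t \<bullet> \<theta>) *\<^sub>R \<phi> (\<Psi> t) \<partial>N)) (at \<theta>)"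
    by (rule has_derivative_compose) (use at_0 in simp)
  then show ?thesis
    by (simp add: inner_diff_right mult.commute flip: exp_add)
qed

lemma bounded_statistic_diff_const: "bounded_statistic N (\<lambda>t. \<Psi> t - c)"
proof
  obtain B where "\<And>t. norm (\<Psi> t) \<le> B"
    using statistic_bounded by blast
  then have "norm (\<Psi> t - c) \<le> B + norm c" for t
    using norm_triangle_ineq4[of "\<Psi> t" c] by (meson add_right_mono order_trans)
  then show "\<exists>B. \<forall>t. norm (\<Psi> t - c) \<le> B"
    by blast
qed measurable

definition partition_fun :: "'b \<Rightarrow> real" where
  "partition_fun \<theta> = (\<integral>t. exp (\<Psi> t \<bullet> \<theta>) \<partial>N)"

definition partition_grad :: "'b \<Rightarrow> 'b" where
  "partition_grad \<theta> = (\<integral>t. exp (\<Psi> t \<bullet> \<theta>) *\<^sub>R \<Psi> t \<partial>N)"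

definition partition_hess :: "'b \<Rightarrow> 'b \<Rightarrow> 'b" where
  "partition_hess \<theta> v = (\<integral>t. (exp (\<Psi> t \<bullet> \<theta>) * (\<Psi> t \<bullet> v)) *\<^sub>R \<Psi> t \<partial>N)"

lemma partition_grad_has_derivative:
  "(partition_grad has_derivative partition_hess \<theta>) (at \<theta>)"
  using has_derivative_integral_exp_inner[of "\<lambda>x. x" \<theta>]
  unfolding partition_grad_def[abs_def] partition_hess_def[abs_def] by simp

lemma inner_partition_hess:
  "w \<bullet> partition_hess \<theta> v = (\<integral>t. exp (\<Psi> t \<bullet> \<theta>) * (\<Psi> t \<bullet> w) * (\<Psi> t \<bullet> v) \<partial>N)"
proof -
  have "integrable N (\<lambda>t. (exp (\<Psi> t \<bullet> \<theta>) * (\<Psi> t \<bullet> v)) *\<^sub>R \<Psi> t)"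
    by (intro integrable_continuous_statistic continuous_intros)
  then show ?thesis
    unfolding partition_hess_def by (simp add: inner_commute[of w] mult_ac flip: integral_inner_left)
qed

lemma inner_partition_hess_nonneg: "0 \<le> v \<bullet> partition_hess \<theta> v"
  unfolding inner_partition_hess by (simp add: mult.assoc)

lemma linear_minus_partition_fun_has_derivative:
  "((\<lambda>\<theta>. s \<bullet> \<theta> - partition_fun \<theta>) has_derivative (\<lambda>v. (s - partition_grad \<theta>) \<bullet> v)) (at \<theta>)"
proof -
  have "integrable N (\<lambda>t. exp (\<Psi> t \<bullet> \<theta>) *\<^sub>R \<Psi> t)"
    by (intro integrable_continuous_statistic continuous_intros)
  then have "partition_grad \<theta> \<bullet> v = (\<integral>t. exp (\<Psi> t \<bullet> \<theta>) * (\<Psi> t \<bullet> v) \<partial>N)" for v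
    by (simp add: partition_grad_def flip: integral_inner_left)
  then have "(partition_fun has_derivative (\<lambda>v. partition_grad \<theta> \<bullet> v)) (at \<theta>)"
    using has_derivative_integral_exp_inner[of "\<lambda>_. 1 :: real" \<theta>]
    unfolding partition_fun_def[abs_def] by simp
  then show ?thesis
    unfolding inner_diff_left by (intro derivative_intros)
qed

lemma partition_grad_eq_at_maximum:
  assumes "\<And>\<theta>'. s \<bullet> \<theta>' - partition_fun \<theta>' \<le> s \<bullet> \<theta> - partition_fun \<theta>"
  shows "partition_grad \<theta> = s"
proof -
  have "(\<lambda>v. (s - partition_grad \<theta>) \<bullet> v) = (\<lambda>v. 0)"
    using linear_minus_partition_fun_has_derivative assms
    by (intro differential_zero_maxmin[of \<theta> UNIV "\<lambda>\<theta>. s \<bullet> \<theta> - partition_fun \<theta>"]) auto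
  then show ?thesis
    using inner_eq_zero_iff[of "s - partition_grad \<theta>"] by (metis right_minus_eq)
qed

end

section \<open>Monotone maps with derivative near the identity\<close>

lemma monotone_if_derivative_nonneg:
  fixes F :: "'a::real_inner \<Rightarrow> 'a"
  assumes deriv: "\<And>x. (F has_derivative F' x) (at x)" and nonneg: "\<And>x v. 0 \<le> v \<bullet> F' x v"
  shows "0 \<le> (y - x) \<bullet> (F y - F x)"
proof -
  let ?\<phi> = "\<lambda>s. (y - x) \<bullet> F (x + s *\<^sub>R (y - x))"
  have "((\<lambda>s. x + s *\<^sub>R (y - x)) has_derivative (\<lambda>r. r *\<^sub>R (y - x))) (at s within {0..1})" for s :: real
    by (auto intro!: derivative_eq_intros)
  then have "(?\<phi> has_derivative (\<lambda>r. (y - x) \<bullet> F' (x + s *\<^sub>R (y - x)) (r *\<^sub>R (y - x))))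
      (at s within {0..1})" for s
    by (intro has_derivative_inner_right has_derivative_compose[OF _ deriv])
  then have "\<exists>s\<in>{0..1}. ?\<phi> 1 - ?\<phi> 0 = (y - x) \<bullet> F' (x + s *\<^sub>R (y - x)) ((1 - 0) *\<^sub>R (y - x))"
    by (intro mvt_very_simple) simp_all
  then obtain s where "(y - x) \<bullet> (F y - F x) = (y - x) \<bullet> F' (x + s *\<^sub>R (y - x)) (y - x)"
    by (auto simp: inner_diff_right)
  then show ?thesis
    using nonneg by simp
qed

lemma norm_diff_increment_le_of_derivative_near_id:
  fixes F :: "'a::real_normed_vector \<Rightarrow> 'a"
  assumes deriv: "\<And>x. x \<in> S \<Longrightarrow> (F has_derivative F' x) (at x)" and "convex S"
    and near_id: "\<And>x v. x \<in> S \<Longrightarrow> norm (v - F' x v) \<le> \<delta> * norm v"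
    and "0 \<le> \<delta>" "x \<in> S" "y \<in> S"
  shows "norm ((y - x) - (F y - F x)) \<le> \<delta> * norm (y - x)"
proof -
  have "norm ((y - F y) - (x - F x)) \<le> \<delta> * norm (y - x)"
  proof (rule differentiable_bound[OF \<open>convex S\<close>])
    show "((\<lambda>x. x - F x) has_derivative (\<lambda>v. v - F' x v)) (at x within S)" if "x \<in> S" for x
      using deriv[OF that] by (auto intro!: derivative_intros intro: has_derivative_at_withinI)
    show "onorm (\<lambda>v. v - F' x v) \<le> \<delta>" if "x \<in> S" for x
      using near_id[OF that] \<open>0 \<le> \<delta>\<close> by (intro onorm_bound)
  qed (use assms in auto)
  then show ?thesis
    by (simp add: algebra_simps)
qed

lemma norm_increment_ge_outside_ball:
  fixes F :: "'a::real_inner \<Rightarrow> 'a"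
  assumes monotone: "\<And>x y. 0 \<le> (y - x) \<bullet> (F y - F x)"
    and sphere: "\<And>x. norm x = r \<Longrightarrow> norm (x - (F x - F 0)) \<le> \<delta> * r"
    and "0 < r" "r < norm y"
  shows "r * (1 - \<delta>) \<le> norm (F y - F 0)"
proof -
  define x where "x = (r / norm y) *\<^sub>R y"
  have "y \<noteq> 0"
    using assms(3,4) by (metis norm_zero less_asym)
  then have norm_x: "norm x = r" and "y = (norm y / r) *\<^sub>R x"
    using assms(3) by (simp_all add: x_def)
  then have "y - x = (norm y / r - 1) *\<^sub>R x"
    by (metis scaleR_left_diff_distrib scaleR_one)
  moreover have "0 < norm y / r - 1"
    using assms(3,4) by simp
  ultimately have "0 \<le> x \<bullet> (F y - F x)"
    using monotone[of y x] by (simp add: zero_le_mult_iff)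
  moreover have "x \<bullet> (x - (F x - F 0)) \<le> r * (\<delta> * r)"
    using sphere[OF norm_x] \<open>0 < r\<close>
    by (intro order_trans[OF norm_cauchy_schwarz]) (simp add: norm_x)
  moreover have "x \<bullet> x = r * r"
    by (metis norm_x power2_eq_square power2_norm_eq_inner)
  ultimately have "r * (r * (1 - \<delta>)) \<le> x \<bullet> (F y - F 0)"
    by (simp add: inner_diff_right algebra_simps)
  also have "\<dots> \<le> r * norm (F y - F 0)"
    using norm_cauchy_schwarz[of x "F y - F 0"] by (simp add: norm_x)
  finally show ?thesis
    using \<open>0 < r\<close> by simp
qed

theorem monotone_near_id_inverse:
  fixes F :: "'a::real_inner \<Rightarrow> 'a"
  assumes deriv: "\<And>x. (F has_derivative F' x) (at x)" and nonneg: "\<And>x v. 0 \<le> v \<bullet> F' x v"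
    and near_id: "\<And>x v. norm x \<le> r \<Longrightarrow> norm (v - F' x v) \<le> \<delta> * norm v"
    and "0 < r" "0 \<le> \<delta>" and small: "norm (F y - F 0) < r * (1 - \<delta>)"
  shows "norm y \<le> r" and "norm (y - (F y - F 0)) \<le> r * \<delta>"
proof -
  have linearization: "norm (x - (F x - F 0)) \<le> \<delta> * norm x" if "norm x \<le> r" for x
    using norm_diff_increment_le_of_derivative_near_id[of "cball 0 r" F F' \<delta> 0 x] deriv near_id
      \<open>0 < r\<close> \<open>0 \<le> \<delta>\<close> that by simp
  show norm_le: "norm y \<le> r"
  proof (rule ccontr)
    assume "\<not> norm y \<le> r"
    then have "r * (1 - \<delta>) \<le> norm (F y - F 0)"
      using monotone_if_derivative_nonneg[OF deriv nonneg] linearization \<open>0 < r\<close>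
      by (intro norm_increment_ge_outside_ball) auto
    with small show False
      by simp
  qed
  show "norm (y - (F y - F 0)) \<le> r * \<delta>"
    using linearization[OF norm_le] mult_left_mono[OF norm_le \<open>0 \<le> \<delta>\<close>] by (simp add: mult.commute)
qed

section \<open>Preconditioning by symmetric matrices\<close>

lemma sym_mat_inner: "sym_mat A \<Longrightarrow> (A *v x) \<bullet> y = x \<bullet> (A *v y)"
  using transpose_matrix_vector[of A x] by (simp add: sym_mat_def dot_lmul_matrix)

lemma pos_def_invertible:
  assumes "pos_def A"
  shows "invertible A"
proof -
  have "x = 0" if "A *v x = 0" for x
    using assms that unfolding pos_def_def by (metis inner_zero_right less_irrefl)
  then show ?thesis
    by (simp add: invertible_left_inverse matrix_left_invertible_ker)
qed

lemma matrix_inv_vector_mult [simp]: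
  fixes A :: "real^'p^'p"
  assumes "invertible A"
  shows "matrix_inv A *v (A *v x) = x" and "A *v (matrix_inv A *v x) = x"
proof -
  have "A ** matrix_inv A = mat 1 \<and> matrix_inv A ** A = mat 1"
    using assms unfolding invertible_def matrix_inv_def by (rule someI_ex)
  then show "matrix_inv A *v (A *v x) = x" "A *v (matrix_inv A *v x) = x"
    by (simp_all add: matrix_vector_mul_assoc)
qed

lemma sym_mat_inner_matrix_inv:
  assumes "sym_mat A" "invertible A"
  shows "(matrix_inv A *v x) \<bullet> y = x \<bullet> (matrix_inv A *v y)"
  using sym_mat_inner[OF assms(1), of "matrix_inv A *v x" "matrix_inv A *v y"] assms(2) by simp

lemma inner_square_sym_mat: "sym_mat A \<Longrightarrow> x \<bullet> ((A ** A) *v x) = (norm (A *v x))\<^sup>2"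
  by (simp add: sym_mat_inner[symmetric] power2_norm_eq_inner flip: matrix_vector_mul_assoc)

lemma norm_le_of_loewner_le_squares:
  fixes D V :: "real^'p^'p"
  assumes "sym_mat D" "sym_mat V" "0 \<le> a" and le: "loewner_le (V ** V) (a\<^sup>2 *\<^sub>R (D ** D))"
  shows "norm (V *v x) \<le> a * norm (D *v x)"
proof (rule power2_le_imp_le)
  have "0 \<le> x \<bullet> ((a\<^sup>2 *\<^sub>R (D ** D) - V ** V) *v x)"
    using le by (simp add: loewner_le_def)
  also have "\<dots> = a\<^sup>2 * (x \<bullet> ((D ** D) *v x)) - x \<bullet> ((V ** V) *v x)"
    by (simp only: matrix_vector_mult_diff_rdistrib scaleR_matrix_vector_assoc[symmetric]
        inner_diff_right inner_scaleR_right)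
  finally show "(norm (V *v x))\<^sup>2 \<le> (a * norm (D *v x))\<^sup>2"
    using assms by (simp add: inner_square_sym_mat power_mult_distrib)
qed (use assms in simp)

lemma norm_matrix_inv_le_of_loewner_le_squares:
  fixes D V :: "real^'p^'p"
  assumes D: "sym_mat D" "invertible D" and V: "sym_mat V" "invertible V"
    and "0 \<le> a" and le: "loewner_le (V ** V) (a\<^sup>2 *\<^sub>R (D ** D))"
  shows "norm (matrix_inv D *v x) \<le> a * norm (matrix_inv V *v x)"
proof -
  define w where "w = matrix_inv D *v x"
  define y where "y = matrix_inv V *v x"
  have "w \<bullet> w = (matrix_inv D *v w) \<bullet> x"
    using D by (simp add: w_def sym_mat_inner_matrix_inv)
  also have "x = V *v y"
    using V by (simp add: y_def)
  also have "(matrix_inv D *v w) \<bullet> (V *v y) = (V *v (matrix_inv D *v w)) \<bullet> y"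
    using V by (simp add: sym_mat_inner)
  also have "\<dots> \<le> norm (V *v (matrix_inv D *v w)) * norm y"
    by (rule norm_cauchy_schwarz)
  also have "\<dots> \<le> a * norm w * norm y"
    using norm_le_of_loewner_le_squares[OF D(1) V(1) \<open>0 \<le> a\<close> le, of "matrix_inv D *v w"] D
    by (intro mult_right_mono) auto
  finally have "norm w * norm w \<le> norm w * (a * norm y)"
    by (simp add: power2_eq_square mult_ac flip: power2_norm_eq_inner)
  then have "norm w \<le> a * norm y"
    using \<open>0 \<le> a\<close> by (cases "w = 0") simp_all
  then show ?thesis
    by (simp add: w_def y_def)
qed

lemma norm_minus_matrix_vector_le:
  fixes N :: "real^'p^'p"
  assumes "opnorm (mat 1 - N) \<le> \<delta>"
  shows "norm (v - N *v v) \<le> \<delta> * norm v"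
proof -
  have "norm ((mat 1 - N) *v v) \<le> opnorm (mat 1 - N) * norm v"
    unfolding opnorm_def by (rule onorm) (rule matrix_vector_mul_bounded_linear)
  also have "\<dots> \<le> \<delta> * norm v"
    using assms by (rule mult_right_mono) simp
  finally show ?thesis
    by (simp add: matrix_vector_mult_diff_rdistrib)
qed

theorem preconditioned_monotone_near_id_inverse:
  fixes F :: "real^'p \<Rightarrow> real^'p" and H :: "real^'p \<Rightarrow> real^'p^'p" and D :: "real^'p^'p"
  assumes deriv: "\<And>\<theta>. (F has_derivative (\<lambda>v. H \<theta> *v v)) (at \<theta>)"
    and nonneg: "\<And>\<theta> v. 0 \<le> v \<bullet> (H \<theta> *v v)"
    and D: "sym_mat D" "invertible D"
    and near_id: "\<And>\<theta>. norm (D *v (\<theta> - \<theta>\<^sub>0)) \<le> r \<Longrightarrow>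
        opnorm (mat 1 - matrix_inv D ** H \<theta> ** matrix_inv D) \<le> \<delta>"
    and "0 < r" "0 \<le> \<delta>"
    and small: "norm (matrix_inv D *v (F \<theta> - F \<theta>\<^sub>0)) < r * (1 - \<delta>)"
  shows "norm (D *v (\<theta> - \<theta>\<^sub>0)) \<le> r"
    and "norm (D *v (\<theta> - \<theta>\<^sub>0) - matrix_inv D *v (F \<theta> - F \<theta>\<^sub>0)) \<le> r * \<delta>"
proof -
  define G where "G u = matrix_inv D *v F (\<theta>\<^sub>0 + matrix_inv D *v u)" for u
  define G' where "G' u = matrix_inv D ** H (\<theta>\<^sub>0 + matrix_inv D *v u) ** matrix_inv D" for u
  define u where "u = D *v (\<theta> - \<theta>\<^sub>0)"
  have G'_mult: "G' u *v v = matrix_inv D *v (H (\<theta>\<^sub>0 + matrix_inv D *v u) *v (matrix_inv D *v v))" for u v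
    by (simp add: G'_def flip: matrix_vector_mul_assoc)
  have G_increment: "G u - G 0 = matrix_inv D *v (F \<theta> - F \<theta>\<^sub>0)"
    using D by (simp add: G_def u_def matrix_vector_mult_diff_distrib)
  have G_deriv: "(G has_derivative (\<lambda>v. G' u *v v)) (at u)" for u
  proof -
    have "((\<lambda>u. \<theta>\<^sub>0 + matrix_inv D *v u) has_derivative (\<lambda>v. matrix_inv D *v v)) (at u)"
      by (auto intro!: derivative_eq_intros bounded_linear_imp_has_derivative
          matrix_vector_mul_bounded_linear)
    then show ?thesis
      unfolding G_def[abs_def] G'_mult
      by (intro bounded_linear.has_derivative[OF matrix_vector_mul_bounded_linear]
          has_derivative_compose[OF _ deriv])
  qed
  have G'_nonneg: "0 \<le> v \<bullet> (G' u *v v)" for u v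
    unfolding G'_mult using nonneg D by (simp flip: sym_mat_inner_matrix_inv)
  have G'_near_id: "norm (v - G' u *v v) \<le> \<delta> * norm v" if "norm u \<le> r" for u v
    unfolding G'_def using that D by (intro norm_minus_matrix_vector_le near_id) simp
  note inverse = monotone_near_id_inverse[OF G_deriv G'_nonneg _ \<open>0 < r\<close> \<open>0 \<le> \<delta>\<close>,
      of u, unfolded G_increment, OF _ small]
  show "norm (D *v (\<theta> - \<theta>\<^sub>0)) \<le> r"
    and "norm (D *v (\<theta> - \<theta>\<^sub>0) - matrix_inv D *v (F \<theta> - F \<theta>\<^sub>0)) \<le> r * \<delta>"
    using inverse G'_near_id unfolding u_def by blast+
qed

section \<open>Standardized random vectors\<close>

lemma (in prob_space) inner_covmat:
  fixes G :: "'a \<Rightarrow> real^'p"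
  assumes [measurable]: "G \<in> borel_measurable M"
    and square_integrable: "integrable M (\<lambda>\<omega>. (norm (G \<omega>))\<^sup>2)"
  shows "x \<bullet> (covmat M G *v x) = variance (\<lambda>\<omega>. x \<bullet> G \<omega>)"
proof -
  define c where "c j \<omega> = G \<omega> $ j - expectation (\<lambda>\<omega>. G \<omega> $ j)" for j \<omega>
  have [measurable]: "(\<lambda>\<omega>. G \<omega> $ j) \<in> borel_measurable M" for j
    using measurable_compose[OF assms(1) borel_measurable_nth] by simp
  have "\<bar>G \<omega> $ j\<bar> * \<bar>G \<omega> $ k\<bar> \<le> norm (G \<omega>) * norm (G \<omega>)" for j k \<omega>
    by (intro mult_mono component_le_norm_cart) auto
  then have integrable_prod: "integrable M (\<lambda>\<omega>. G \<omega> $ j * G \<omega> $ k)" for j k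
    by (intro Bochner_Integration.integrable_bound[OF square_integrable])
       (simp_all add: abs_mult power2_eq_square)
  have integrable_nth: "integrable M (\<lambda>\<omega>. G \<omega> $ j)" for j
    by (rule square_integrable_imp_integrable)
       (use integrable_prod[of j j] in \<open>simp_all add: power2_eq_square\<close>)
  have integrable_centred_prod: "integrable M (\<lambda>\<omega>. c j \<omega> * c k \<omega>)" for j k
    using integrable_prod integrable_nth by (simp add: c_def algebra_simps)
  have "x \<bullet> G \<omega> - expectation (\<lambda>\<omega>. x \<bullet> G \<omega>) = (\<Sum>j\<in>UNIV. x $ j * c j \<omega>)" for \<omega>
    using integrable_nth by (simp add: inner_vec_def c_def right_diff_distrib sum_subtractf)
  then have "(x \<bullet> G \<omega> - expectation (\<lambda>\<omega>. x \<bullet> G \<omega>))\<^sup>2 =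
      (\<Sum>j\<in>UNIV. \<Sum>k\<in>UNIV. x $ j * (x $ k * (c j \<omega> * c k \<omega>)))" for \<omega>
    by (simp add: power2_eq_square sum_product mult_ac)
  then have "variance (\<lambda>\<omega>. x \<bullet> G \<omega>) =
      (\<Sum>j\<in>UNIV. \<Sum>k\<in>UNIV. x $ j * (x $ k * expectation (\<lambda>\<omega>. c j \<omega> * c k \<omega>)))"
    using integrable_centred_prod by (simp add: Bochner_Integration.integral_sum)
  also have "\<dots> = x \<bullet> (covmat M G *v x)"
    by (simp add: inner_vec_def matrix_vector_mult_def covmat_def c_def sum_distrib_left mult_ac)
  finally show ?thesis
    by simp
qed

lemma (in prob_space) variance_standardized:
  fixes G :: "'a \<Rightarrow> real^'p"
  assumes "G \<in> borel_measurable M" "integrable M (\<lambda>\<omega>. (norm (G \<omega>))\<^sup>2)"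
    and V: "sym_mat V" "invertible V" "V ** V = covmat M G"
  shows "variance (\<lambda>\<omega>. u \<bullet> (matrix_inv V *v G \<omega>)) = (norm u)\<^sup>2"
proof -
  have "variance (\<lambda>\<omega>. u \<bullet> (matrix_inv V *v G \<omega>)) = variance (\<lambda>\<omega>. (matrix_inv V *v u) \<bullet> G \<omega>)"
    using V by (simp add: sym_mat_inner_matrix_inv)
  also have "\<dots> = (matrix_inv V *v u) \<bullet> (covmat M G *v (matrix_inv V *v u))"
    using assms(1,2) by (rule inner_covmat[symmetric])
  also have "\<dots> = (norm u)\<^sup>2"
    using V inner_square_sym_mat[of V "matrix_inv V *v u"] by simp
  finally show ?thesis .
qed

lemma (in prob_space) locally_subgaussian_linear_imageI:
  fixes G :: "'a \<Rightarrow> real^'p" and A :: "real^'p^'q"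
  assumes "bounded_statistic M G" and mean_zero: "expectation G = 0"
    and ln_mgf_le: "\<And>\<gamma> s. \<gamma> \<noteq> 0 \<Longrightarrow> \<bar>s\<bar> \<le> g \<Longrightarrow>
      ln (expectation (\<lambda>\<omega>. exp (s * (\<gamma> \<bullet> (A *v G \<omega> -
        expectation (\<lambda>\<omega>. A *v G \<omega>))) / norm \<gamma>))) \<le> \<nu>\<^sup>2 * s\<^sup>2 / 2"
  shows "locally_subgaussian (\<lambda>\<omega>. A *v G \<omega>) \<nu> g"
proof -
  interpret G: bounded_statistic M G
    by fact
  have linear_A: "bounded_linear ((*v) A)"
    by (rule matrix_vector_mul_bounded_linear)
  note continuous_A = bounded_linear.continuous_on[OF linear_A]
  have integrable_exp: "integrable M (\<lambda>\<omega>. exp (v \<bullet> (A *v G \<omega>)))" for v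
    by (intro G.integrable_continuous_statistic continuous_intros continuous_A)
  have "integrable M (\<lambda>\<omega>. A *v G \<omega>)" and integrable_G: "integrable M G"
    using G.integrable_continuous_statistic[of "\<lambda>x. x"]
    by (auto intro!: G.integrable_continuous_statistic continuous_intros continuous_A)
  then have measurable: "(\<lambda>\<omega>. A *v G \<omega>) \<in> borel_measurable M"
    by simp
  have mean: "expectation (\<lambda>\<omega>. A *v G \<omega>) = 0"
    using integral_bounded_linear[OF linear_A integrable_G] mean_zero by simp
  have "expectation (\<lambda>\<omega>. exp (v \<bullet> (A *v G \<omega>))) \<le> exp (\<nu>\<^sup>2 * (norm v)\<^sup>2 / 2)" if "norm v \<le> g" for v
  proof (cases "v = 0")
    case False
    have "ln (expectation (\<lambda>\<omega>. exp (v \<bullet> (A *v G \<omega>)))) \<le> \<nu>\<^sup>2 * (norm v)\<^sup>2 / 2"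
      using ln_mgf_le[OF False, of "norm v"] that False by (simp add: mean)
    moreover have "0 < expectation (\<lambda>\<omega>. exp (v \<bullet> (A *v G \<omega>)))"
      using integrable_exp by (intro expectation_greater) auto
    ultimately show ?thesis
      by (metis exp_le_cancel_iff exp_ln)
  qed (simp add: prob_space)
  then show ?thesis
    using integrable_exp measurable by (simp add: locally_subgaussian_def)
qed

lemma (in prob_space) standardized_subgaussian_parameter_ge_1:
  fixes G :: "'a \<Rightarrow> real^'p"
  assumes G: "bounded_statistic M G" and mean_zero: "expectation G = 0"
    and V: "sym_mat V" "invertible V" "V ** V = covmat M G"
    and subgaussian: "locally_subgaussian (\<lambda>\<omega>. matrix_inv V *v G \<omega>) \<nu> g" and "0 < \<nu>" "0 < g"
  shows "1 \<le> \<nu>"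
proof -
  interpret G: bounded_statistic M G
    by fact
  obtain e :: "real^'p" where norm_e: "norm e = 1"
    using vector_choose_size[of 1] by auto
  have integrable_G: "integrable M G" "integrable M (\<lambda>\<omega>. (norm (G \<omega>))\<^sup>2)"
    by (intro G.integrable_continuous_statistic continuous_intros)+
  have "expectation (\<lambda>\<omega>. e \<bullet> (matrix_inv V *v G \<omega>)) = e \<bullet> (matrix_inv V *v expectation G)"
    using integrable_G(1)
    by (intro integral_bounded_linear matrix_vector_mul_bounded_linear
        bounded_linear_compose[OF bounded_linear_inner_right])
  then have "expectation (\<lambda>\<omega>. (e \<bullet> (matrix_inv V *v G \<omega>))\<^sup>2) = 1"
    using variance_standardized[OF _ integrable_G(2) V, of e] norm_e mean_zero by simp
  then have "1 \<le> \<nu>\<^sup>2"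
    using locally_subgaussian_second_moment_le[OF subgaussian \<open>0 < g\<close>, of e] norm_e by simp
  then show ?thesis
    using \<open>0 < \<nu>\<close> by (simp add: power2_le_imp_le[of 1 \<nu>])
qed

theorem (in prob_space) standardized_deviation_bound:
  fixes G :: "'a \<Rightarrow> real^'p" and V :: "real^'p^'p"
  assumes G: "bounded_statistic M G" "expectation G = 0"
    and V: "sym_mat V" "invertible V" "V ** V = covmat M G"
    and ln_mgf_le: "\<And>\<gamma> s. \<gamma> \<noteq> 0 \<Longrightarrow> \<bar>s\<bar> \<le> g \<Longrightarrow>
      ln (expectation (\<lambda>\<omega>. exp (s * (\<gamma> \<bullet> (matrix_inv V *v G \<omega> -
        expectation (\<lambda>\<omega>. matrix_inv V *v G \<omega>))) / norm \<gamma>))) \<le> \<nu>\<^sup>2 * s\<^sup>2 / 2"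
    and pos: "0 < \<nu>" "0 < g" and z_range: "0 \<le> z" "z \<le> g\<^sup>2 / 4"
  defines "t \<equiv> 2 * \<nu> * (sqrt (real CARD('p)) + sqrt (2 * z))"
  defines "A \<equiv> {\<omega> \<in> space M. norm (matrix_inv V *v G \<omega>) < t}"
  shows "A \<in> events" and "1 - 2 * exp (- z) \<le> prob A"
proof -
  have subgaussian: "locally_subgaussian (\<lambda>\<omega>. matrix_inv V *v G \<omega>) \<nu> g"
    using G ln_mgf_le by (rule locally_subgaussian_linear_imageI)
  then have [measurable]: "(\<lambda>\<omega>. matrix_inv V *v G \<omega>) \<in> borel_measurable M"
    by (simp add: locally_subgaussian_def)
  show "A \<in> events"
    unfolding A_def by measurable
  have "prob {\<omega> \<in> space M. t \<le> norm (matrix_inv V *v G \<omega>)} \<le> 2 * exp (- z)"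
    using locally_subgaussian_deviation_bound[OF subgaussian _ _ z_range] pos
      standardized_subgaussian_parameter_ge_1[OF G V subgaussian pos] by (simp add: t_def)
  moreover have "space M - A = {\<omega> \<in> space M. t \<le> norm (matrix_inv V *v G \<omega>)}"
    by (auto simp: A_def)
  ultimately show "1 - 2 * exp (- z) \<le> prob A"
    using prob_compl[OF \<open>A \<in> events\<close>] by simp
qed

section \<open>The local likelihood\<close>

lemma grad_at_eqI:
  assumes "(F has_derivative (\<lambda>v. g \<bullet> v)) (at x)"
  shows "grad_at F x = g"
  unfolding grad_at_def
proof (rule the_equality[where P = "\<lambda>g. (F has_derivative (\<lambda>v. g \<bullet> v)) (at x)", OF assms])
  fix g' assume "(F has_derivative (\<lambda>v. g' \<bullet> v)) (at x)"
  then have "g' \<bullet> v = g \<bullet> v" for v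
    using has_derivative_unique[OF _ assms] by metis
  then show "g' = g"
    using vector_eq_rdot by blast
qed

definition base_measure :: "(real^'d \<Rightarrow> real) \<Rightarrow> nat \<Rightarrow> real \<Rightarrow> (real^'d) measure" where
  "base_measure K n h =
    density lborel (\<lambda>t. ennreal (indicator unit_cube t * (real n * h ^ CARD('d) * K t)))"

lemma unit_cube_measurable [measurable]: "unit_cube \<in> sets borel"
  by (simp add: unit_cube_def)

locale local_likelihood =
  fixes K :: "real^'d \<Rightarrow> real" and Psi :: "real^'d \<Rightarrow> real^'p" and n :: nat and h :: real
  assumes K_measurable [measurable]: "K \<in> borel_measurable borel"
    and K_bounded: "\<exists>B. \<forall>t. \<bar>K t\<bar> \<le> B" and K_nonneg: "0 \<le> K t"
    and Psi_measurable [measurable]: "Psi \<in> borel_measurable borel"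
    and Psi_bounded: "\<exists>B. \<forall>t. norm (Psi t) \<le> B"
    and bandwidth_pos: "0 < h"
begin

lemma integral_base_measure:
  fixes \<phi> :: "real^'d \<Rightarrow> 'c::{banach,second_countable_topology}"
  assumes "\<phi> \<in> borel_measurable borel"
  shows "(\<integral>t. \<phi> t \<partial>base_measure K n h) =
    (real n * h ^ CARD('d)) *\<^sub>R (\<integral>t\<in>unit_cube. K t *\<^sub>R \<phi> t \<partial>lborel)"
proof -
  have "(\<integral>t. \<phi> t \<partial>base_measure K n h) =
      (\<integral>t. (indicator unit_cube t * (real n * h ^ CARD('d) * K t)) *\<^sub>R \<phi> t \<partial>lborel)"
    unfolding base_measure_def using assms K_nonneg bandwidth_pos by (subst integral_density) auto
  also have "\<dots> = (\<integral>t. (real n * h ^ CARD('d)) *\<^sub>R indicator unit_cube t *\<^sub>R K t *\<^sub>R \<phi> t \<partial>lborel)"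
    by (simp add: mult_ac)
  finally show ?thesis
    by (simp only: set_lebesgue_integral_def integral_scaleR_right)
qed

lemma finite_measure_base_measure: "finite_measure (base_measure K n h)"
proof
  obtain B where B: "\<And>t. \<bar>K t\<bar> \<le> B"
    using K_bounded by blast
  define C where "C = real n * h ^ CARD('d) * B"
  have "emeasure (base_measure K n h) (space (base_measure K n h)) =
      (\<integral>\<^sup>+t. ennreal (indicator unit_cube t * (real n * h ^ CARD('d) * K t)) \<partial>lborel)"
    unfolding base_measure_def by (subst emeasure_density) auto
  also have "\<dots> \<le> (\<integral>\<^sup>+t. ennreal C * indicator (unit_cube :: (real^'d) set) t \<partial>lborel)"
  proof (rule nn_integral_mono)
    fix t
    have "real n * h ^ CARD('d) * K t \<le> C"
      unfolding C_def using B[of t] bandwidth_pos by (intro mult_left_mono) auto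
    then show "ennreal (indicator unit_cube t * (real n * h ^ CARD('d) * K t)) \<le>
        ennreal C * indicator unit_cube t"
      by (auto simp: indicator_def intro: ennreal_leI)
  qed
  also have "\<dots> = ennreal C * emeasure lborel (unit_cube :: (real^'d) set)"
    by (rule nn_integral_cmult_indicator) simp
  also have "\<dots> < \<infinity>"
    using emeasure_lborel_cbox_finite[of "- 1 :: real^'d" 1]
    by (simp add: unit_cube_def ennreal_mult_less_top)
  finally show "emeasure (base_measure K n h) (space (base_measure K n h)) \<noteq> \<infinity>"
    by simp
qed

sublocale basis: bounded_statistic "base_measure K n h" Psi
  by (intro bounded_statistic.intro bounded_statistic_axioms.intro finite_measure_base_measure
      Psi_bounded)
     (simp add: base_measure_def)

lemma partition_fun_eq:
  "basis.partition_fun \<theta> = real n * h ^ CARD('d) * (\<integral>t\<in>unit_cube. K t * exp (Psi t \<bullet> \<theta>) \<partial>lborel)"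
  unfolding basis.partition_fun_def by (subst integral_base_measure) simp_all

lemma Dn2_nth:
  "Dn2 K Psi n h \<theta> $ j $ k = (\<integral>t. exp (Psi t \<bullet> \<theta>) * (Psi t $ j * Psi t $ k) \<partial>base_measure K n h)"
proof -
  have [measurable]: "(\<lambda>t. Psi t $ j) \<in> borel_measurable borel" for j
    using measurable_compose[OF Psi_measurable borel_measurable_nth] by simp
  show ?thesis
    by (subst integral_base_measure) (simp_all add: Dn2_def mult_ac)
qed

lemma Dn2_mult_eq_partition_hess: "Dn2 K Psi n h \<theta> *v v = basis.partition_hess \<theta> v"
  unfolding vec_eq_iff
proof
  fix j
  have integrable_entry:
    "integrable (base_measure K n h) (\<lambda>t. exp (Psi t \<bullet> \<theta>) * (Psi t $ j * Psi t $ k))" for k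
    by (intro basis.integrable_continuous_statistic continuous_intros)
  have "(Dn2 K Psi n h \<theta> *v v) $ j =
      (\<integral>t. (\<Sum>k\<in>UNIV. exp (Psi t \<bullet> \<theta>) * (Psi t $ j * Psi t $ k) * v $ k) \<partial>base_measure K n h)"
    using integrable_entry by (simp add: matrix_vector_mult_def Dn2_nth Bochner_Integration.integral_sum)
  also have "\<dots> = axis j 1 \<bullet> basis.partition_hess \<theta> v"
    unfolding basis.inner_partition_hess
    by (simp add: inner_axis inner_vec_def[of "Psi _" v] sum_distrib_left mult_ac)
  finally show "(Dn2 K Psi n h \<theta> *v v) $ j = basis.partition_hess \<theta> v $ j"
    by (simp add: inner_axis')
qed

lemma partition_grad_has_derivative_Dn2:
  "(basis.partition_grad has_derivative (\<lambda>v. Dn2 K Psi n h \<theta> *v v)) (at \<theta>)"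
  unfolding Dn2_mult_eq_partition_hess using basis.partition_grad_has_derivative .

lemma Dn2_nonneg: "0 \<le> v \<bullet> (Dn2 K Psi n h \<theta> *v v)"
  unfolding Dn2_mult_eq_partition_hess by (rule basis.inner_partition_hess_nonneg)

end

locale local_likelihood_sample = local_likelihood K Psi n h + prob_space M
  for K :: "real^'d \<Rightarrow> real" and Psi :: "real^'d \<Rightarrow> real^'p" and n h and M :: "'w measure" +
  fixes X :: "'w \<Rightarrow> nat \<Rightarrow> real^'d" and x0 :: "real^'d"
  assumes X_measurable: "\<And>i. i < n \<Longrightarrow> (\<lambda>\<omega>. X \<omega> i) \<in> borel_measurable M"
begin

definition sample_statistic :: "'w \<Rightarrow> real^'p" where
  "sample_statistic \<omega> =
    (\<Sum>i<n. K (rescale h x0 (X \<omega> i)) *\<^sub>R Psi (rescale h x0 (X \<omega> i)))"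

lemma loglik_eq: "loglik K Psi X n h x0 \<theta> \<omega> = sample_statistic \<omega> \<bullet> \<theta> - basis.partition_fun \<theta>"
  by (simp add: loglik_def sample_statistic_def partition_fun_eq inner_sum_left)

lemma bounded_statistic_sample_statistic: "bounded_statistic M sample_statistic"
proof
  have [measurable]: "(\<lambda>\<omega>. rescale h x0 (X \<omega> i)) \<in> borel_measurable M" if "i < n" for i
    using X_measurable[OF that] unfolding rescale_def by measurable
  show "sample_statistic \<in> borel_measurable M"
    unfolding sample_statistic_def[abs_def] by measurable
  obtain B C where B: "\<And>t. \<bar>K t\<bar> \<le> B" and C: "\<And>t. norm (Psi t) \<le> C"
    using K_bounded Psi_bounded by blast
  have "norm (K t *\<^sub>R Psi t) \<le> B * C" for t
    using B C order_trans[OF abs_ge_zero B] by (auto intro!: mult_mono)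
  then have "norm (sample_statistic \<omega>) \<le> real n * (B * C)" for \<omega>
    unfolding sample_statistic_def by (intro order_trans[OF sum_norm_bound]) auto
  then show "\<exists>B. \<forall>\<omega>. norm (sample_statistic \<omega>) \<le> B"
    by blast
qed

sublocale sample: bounded_statistic M sample_statistic
  by (rule bounded_statistic_sample_statistic)

lemma integrable_sample_statistic: "integrable M sample_statistic"
  by (intro sample.integrable_continuous_statistic continuous_on_id)

lemma partition_grad_at_maximum_expected_likelihood:
  assumes "\<And>\<theta>. expectation (loglik K Psi X n h x0 \<theta>) \<le> expectation (loglik K Psi X n h x0 \<theta>')"
  shows "basis.partition_grad \<theta>' = expectation sample_statistic"
proof -
  have "expectation (loglik K Psi X n h x0 \<theta>) =
      expectation sample_statistic \<bullet> \<theta> - basis.partition_fun \<theta>" for \<theta>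
    unfolding loglik_eq[abs_def] using integrable_sample_statistic by (simp add: prob_space)
  with assms show ?thesis
    by (intro basis.partition_grad_eq_at_maximum) simp
qed

lemma grad_at_loglik:
  "grad_at (\<lambda>\<theta>. loglik K Psi X n h x0 \<theta> \<omega>) \<theta> = sample_statistic \<omega> - basis.partition_grad \<theta>"
  unfolding loglik_eq by (rule grad_at_eqI) (rule basis.linear_minus_partition_fun_has_derivative)

lemma grad_at_loglik_eq_increment:
  assumes "\<And>\<theta>. loglik K Psi X n h x0 \<theta> \<omega> \<le> loglik K Psi X n h x0 \<theta>' \<omega>"
  shows "grad_at (\<lambda>\<theta>. loglik K Psi X n h x0 \<theta> \<omega>) \<theta> = basis.partition_grad \<theta>' - basis.partition_grad \<theta>"
  unfolding grad_at_loglik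
  using basis.partition_grad_eq_at_maximum[of "sample_statistic \<omega>" \<theta>'] assms by (simp add: loglik_eq)

lemma score_at_maximum_expected_likelihood:
  assumes "\<And>\<theta>'. expectation (loglik K Psi X n h x0 \<theta>') \<le> expectation (loglik K Psi X n h x0 \<theta>)"
  defines "score \<equiv> \<lambda>\<omega>. grad_at (\<lambda>\<theta>. loglik K Psi X n h x0 \<theta> \<omega>) \<theta>"
  shows "bounded_statistic M score" and "expectation score = 0"
proof -
  have "score = (\<lambda>\<omega>. sample_statistic \<omega> - expectation sample_statistic)"
    using assms(1) by (simp add: score_def grad_at_loglik partition_grad_at_maximum_expected_likelihood)
  then show "bounded_statistic M score" and "expectation score = 0"
    using sample.bounded_statistic_diff_const integrable_sample_statistic by (simp_all add: prob_space)
qed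

theorem maximum_likelihood_expansion:
  assumes maximum: "\<And>\<theta>. loglik K Psi X n h x0 \<theta> \<omega> \<le> loglik K Psi X n h x0 \<theta>' \<omega>"
    and D: "sym_mat D" "invertible D"
    and near_id: "\<And>\<theta>'. norm (D *v (\<theta>' - \<theta>)) \<le> r \<Longrightarrow>
      opnorm (mat 1 - matrix_inv D ** Dn2 K Psi n h \<theta>' ** matrix_inv D) \<le> \<delta>"
    and "0 < r" "0 \<le> \<delta>"
  defines "\<xi> \<equiv> matrix_inv D *v grad_at (\<lambda>\<theta>. loglik K Psi X n h x0 \<theta> \<omega>) \<theta>"
  assumes small: "norm \<xi> < r * (1 - \<delta>)"
  shows "norm (D *v (\<theta>' - \<theta>)) \<le> r" and "norm (D *v (\<theta>' - \<theta>) - \<xi>) \<le> r * \<delta>"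
proof -
  have \<xi>_eq: "\<xi> = matrix_inv D *v (basis.partition_grad \<theta>' - basis.partition_grad \<theta>)"
    unfolding \<xi>_def by (simp add: grad_at_loglik_eq_increment[OF maximum])
  show "norm (D *v (\<theta>' - \<theta>)) \<le> r" and "norm (D *v (\<theta>' - \<theta>) - \<xi>) \<le> r * \<delta>"
    using preconditioned_monotone_near_id_inverse[OF partition_grad_has_derivative_Dn2 Dn2_nonneg D
        near_id \<open>0 < r\<close> \<open>0 \<le> \<delta>\<close>] small unfolding \<xi>_eq by blast+
qed

end

theorem theorem2:
  fixes M :: "'w measure"
    and X :: "'w \<Rightarrow> nat \<Rightarrow> real^'d"
    and f :: "real^'d \<Rightarrow> real"
    and K :: "real^'d \<Rightarrow> real"
    and Psi :: "real^'d \<Rightarrow> real^'p"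
    and i0 :: 'p
    and n :: nat and h :: real and x0 :: "real^'d"
    and theta_t :: "'w \<Rightarrow> real^'p" and theta_s :: "real^'p"
    and D V :: "real^'p^'p"
    and a g \<nu>0 z \<delta> :: real
  defines "L \<equiv> loglik K Psi X n h x0"
      and "gradL \<equiv> (\<lambda>\<omega>. grad_at (\<lambda>\<theta>. loglik K Psi X n h x0 \<theta> \<omega>) theta_s)"
      and "r0 \<equiv> 4 * a * \<nu>0 * (sqrt (real CARD('p)) + sqrt (2 * z))"
      and "zeta_pz \<equiv> a * \<nu>0 * (sqrt (real CARD('p)) + sqrt (2 * z))"
  assumes M: "prob_space M"
    and n_pos: "n \<ge> 1" and h_pos: "h > 0"
    \<comment> \<open>X 0, ..., X (n-1): i.i.d. with Lebesgue density f\<close>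
    and X_meas: "\<And>i. i < n \<Longrightarrow> (\<lambda>\<omega>. X \<omega> i) \<in> borel_measurable M"
    and X_indep: "prob_space.indep_vars M (\<lambda>_. borel) (\<lambda>i \<omega>. X \<omega> i) {..<n}"
    and f_meas: "f \<in> borel_measurable lborel" and f_nonneg: "\<And>x. 0 \<le> f x"
    and X_distr: "\<And>i. i < n \<Longrightarrow> distributed M lborel (\<lambda>\<omega>. X \<omega> i) (\<lambda>x. ennreal (f x))"
    \<comment> \<open>kernel\<close>
    and K_meas: "K \<in> borel_measurable lborel"
    and K_bdd: "\<exists>B. \<forall>t. \<bar>K t\<bar> \<le> B"
    and K_nonneg: "\<And>t. 0 \<le> K t"
    and K_supp: "\<And>t. t \<notin> unit_cube \<Longrightarrow> K t = 0"
    \<comment> \<open>basis functions psi_0, ..., psi_{p-1}\<close>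
    and Psi_meas: "Psi \<in> borel_measurable lborel"
    and Psi_bdd: "\<exists>B. \<forall>t. norm (Psi t) \<le> B"
    and Psi_supp: "\<And>t. t \<notin> unit_cube \<Longrightarrow> Psi t = 0"
    and Psi0: "\<And>t. t \<in> unit_cube \<Longrightarrow> Psi t $ i0 = 1"
    and Psi_indep: "\<And>c. (\<forall>t. 0 < K t \<longrightarrow> c \<bullet> Psi t = 0) \<Longrightarrow> c = 0"
    \<comment> \<open>maximizers (assumed to exist)\<close>
    and theta_t_max: "\<And>\<omega> \<theta>. \<omega> \<in> space M \<Longrightarrow> L \<theta> \<omega> \<le> L (theta_t \<omega>) \<omega>"
    and theta_s_max: "\<And>\<theta>. (\<integral>\<omega>. L \<theta> \<omega> \<partial>M) \<le> (\<integral>\<omega>. L theta_s \<omega> \<partial>M)"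
    \<comment> \<open>D_n = symmetric positive definite square root of D_n^2 = D_n^2(theta*)\<close>
    and D_sym: "sym_mat D" and D_pd: "pos_def D" and D_sq: "D ** D = Dn2 K Psi n h theta_s"
    \<comment> \<open>V_n^2 = Var(grad L(theta*)) positive definite; V_n its symmetric p.d. square root\<close>
    and Vn2_pd: "pos_def (covmat M gradL)"
    and V_sym: "sym_mat V" and V_pd: "pos_def V" and V_sq: "V ** V = covmat M gradL"
    \<comment> \<open>condition (I)\<close>
    and a_pos: "a > 0"
    and cond_I: "loewner_le (covmat M gradL) (a\<^sup>2 *\<^sub>R Dn2 K Psi n h theta_s)"
    \<comment> \<open>condition (ED0)\<close>
    and g_pos: "g > 0" and nu0_pos: "\<nu>0 > 0"
    and cond_ED0: "\<And>\<gamma> lam. \<gamma> \<noteq> 0 \<Longrightarrow> \<bar>lam\<bar> \<le> g \<Longrightarrow>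
        ln (\<integral>\<omega>. exp (lam * (\<gamma> \<bullet> (matrix_inv V *v gradL \<omega> - (\<integral>\<omega>'. matrix_inv V *v gradL \<omega>' \<partial>M))) / norm \<gamma>) \<partial>M) \<le> \<nu>0\<^sup>2 * lam\<^sup>2 / 2"
    \<comment> \<open>condition (L0), with delta = delta_n(r0(z))\<close>
    and delta_nonneg: "\<delta> \<ge> 0"
    and cond_L0: "\<And>\<theta>. norm (D *v (\<theta> - theta_s)) \<le> r0 \<Longrightarrow>
        opnorm (mat 1 - matrix_inv D ** Dn2 K Psi n h \<theta> ** matrix_inv D) \<le> \<delta>"
    \<comment> \<open>condition (C)\<close>
    and cond_C: "r0 * (1 - \<delta>) \<ge> 2 * zeta_pz"
    \<comment> \<open>range of z\<close>
    and z_pos: "z > 0" and z_le: "z \<le> g\<^sup>2 / 4"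
  shows "\<exists>A \<in> sets M. measure M A \<ge> 1 - (2 * exp (- z) + 8.4 * exp (- g\<^sup>2 / 4)) \<and>
           (\<forall>\<omega> \<in> A. norm (D *v (theta_t \<omega> - theta_s)) \<le> r0 \<and> norm (D *v (theta_t \<omega> - theta_s) - matrix_inv D *v gradL \<omega>) \<le> r0 * \<delta>)"
proof -
  interpret local_likelihood_sample K Psi n h M X x0
    using M K_meas K_bdd K_nonneg Psi_meas Psi_bdd h_pos X_meas
    by (auto simp: local_likelihood_sample_def local_likelihood_sample_axioms_def local_likelihood_def)
  have D_inv: "invertible D" and V_inv: "invertible V"
    using D_pd V_pd by (auto intro: pos_def_invertible)
  have score: "bounded_statistic M gradL" "expectation gradL = 0"
    using theta_s_max unfolding L_def gradL_def by (rule score_at_maximum_expected_likelihood)+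
  define A where "A = {\<omega> \<in> space M. norm (matrix_inv V *v gradL \<omega>) <
    2 * \<nu>0 * (sqrt (real CARD('p)) + sqrt (2 * z))}"
  have A_event: "A \<in> events" and prob_A: "1 - 2 * exp (- z) \<le> prob A"
    unfolding A_def using z_pos z_le nu0_pos g_pos
    by (auto intro!: standardized_deviation_bound[OF score V_sym V_inv V_sq cond_ED0])
  have small: "norm (matrix_inv D *v gradL \<omega>) < r0 * (1 - \<delta>)" if "\<omega> \<in> A" for \<omega>
  proof -
    have "norm (matrix_inv D *v gradL \<omega>) \<le> a * norm (matrix_inv V *v gradL \<omega>)"
      using D_sym D_inv V_sym V_inv a_pos cond_I
      by (intro norm_matrix_inv_le_of_loewner_le_squares) (simp_all add: D_sq V_sq)
    also have "\<dots> < 2 * zeta_pz"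
      using that a_pos by (simp add: A_def zeta_pz_def)
    finally show ?thesis
      using cond_C by simp
  qed
  have "0 < r0"
    using a_pos nu0_pos z_pos by (simp add: r0_def add_nonneg_pos)
  then have "norm (D *v (theta_t \<omega> - theta_s)) \<le> r0 \<and>
      norm (D *v (theta_t \<omega> - theta_s) - matrix_inv D *v gradL \<omega>) \<le> r0 * \<delta>" if "\<omega> \<in> A" for \<omega>
    using maximum_likelihood_expansion[OF _ D_sym D_inv cond_L0] theta_t_max delta_nonneg small that
    unfolding A_def L_def gradL_def by blast
  moreover have "1 - (2 * exp (- z) + 8.4 * exp (- g\<^sup>2 / 4)) \<le> prob A"
    using prob_A exp_ge_zero[of "- g\<^sup>2 / 4"] by linarith
  ultimately show ?thesis
    using A_event by blast
qed

end
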